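(* Let $G\rightrightarrows X$ be a Lie groupoid whose source fibers are $n$-dimensional ($n\ge1$), and let $\Omega:G^{(n)}\to\mathbb{C}$ be a normalized, $S_n$-antisymmetric $n$-cochain on $G$. Let $x\in X$, let $(y^1,\ldots,y^n)$ be local coordinates on the source fiber $s^{-1}(x)$ in a neighborhood of the identity arrow at $x$, let $(x^1,\ldots,x^n)$ be the coordinates of that identity arrow, and let $(y_1^1,\ldots,y_1^n,\ldots,y_n^1,\ldots,y_n^n)$ be the induced coordinates on $G^{(n)}_x=s^{-1}(x)\times\cdots\times s^{-1}(x)$ ($n$ factors) near $(x,\ldots,x)$. Then, up to order $n$ in these coordinates, the asymptotic (Taylor) expansion at $(x,\ldots,x)$ of the restriction $\Omega_x=\Omega|_{G^{(n)}_x}$ is given by $$\frac{1}{n!}\,VE(\Omega)(\partial_{y^1},\ldots,\partial_{y^n})\,\mathrm{Vol}_\Delta(x^1,\ldots,x^n,y_1^1,\ldots,y_1^n,\ldots,y_n^1,\ldots,y_n^n);$$ that is, this polynomial is the Taylor polynomial of $\Omega_x$ of total degree $n$ at $(x,\ldots,x)$. Here $\mathrm{Vol}_\Delta(x^1,\ldots,x^n,y_1^1,\ldots,y_n^n)$ is the determinant of the $n$ vectors $(y_1^1-x^1,\ldots,y_1^n-x^n),\ldots,(y_n^1-x^1,\ldots,y_n^n-x^n)\in\mathbb{R}^n$, and $\partial_{y^j}\in\mathfrak{g}_x$ is the coordinate vector at the identity arrow at $x$.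
   Context: For a Lie groupoid $G\rightrightarrows X$ with source $s$ and target $t$, composition $gh$ is defined when $t(g)=s(h)$. Write $G^{(n)}=\{(g_1,\ldots,g_n)\in G^n: s(g_1)=\cdots=s(g_n)\}$, which is identified with the space of $n$-composable arrows via $(g_1,\ldots,g_n)\mapsto(g_1,g_1g_2,\ldots,g_1\cdots g_n)$. An $n$-cochain is a smooth function $\Omega:G^{(n)}\to\mathbb{C}$. It is normalized if $\Omega(g_1,\ldots,g_n)=0$ whenever some $g_j$ is an identity arrow. It is $S_n$-antisymmetric if $\Omega(g_{\sigma(1)},\ldots,g_{\sigma(n)})=\mathrm{sgn}(\sigma)\Omega(g_1,\ldots,g_n)$ for all $\sigma\in S_n$. For $x\in X$, $G^{(n)}_x=\{(g_1,\ldots,g_n)\in G^{(n)}:s(g_1)=x\}$, and $(x,\ldots,x)$ denotes the tuple of identity arrows at $x$. The Lie algebroid $\mathfrak{g}\to X$ has fiber $\mathfrak{g}_x=T_{\mathrm{id}_x}s^{-1}(x)$, the vectors tangent to the source fiber at the identity. The van Est map is $$VE(\Omega)(V_1,\ldots,V_n)=n!\,V_1\cdots V_n\,\mathrm{Alt}_n(\Omega),\qquad V_1,\ldots,V_n\in\mathfrak{g}_x,$$ where $V_j$ differentiates in the $j$th component at the identity arrow $\mathrm{id}_x$, and $\mathrm{Alt}_n(\Omega)(g_1,\ldots,g_n)=\frac1{n!}\sum_{\sigma\in S_n}\mathrm{sgn}(\sigma)\,\Omega(g_{\sigma(1)},\ldots,g_{\sigma(n)})$. *)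

theory Defs
  imports "HOL-Analysis.Analysis" "Jordan_Normal_Form.Determinant"
begin

section \<open>Smooth functions on open subsets of Euclidean space\<close>

text \<open>
  Dimensions are natural numbers (the value 0 is allowed): \<open>\<real>\<^sup>d\<close> is the library's
  \<^const>\<open>Euclidean_space\<close>, i.e. the sequences \<^typ>\<open>nat \<Rightarrow> real\<close> vanishing
  from index \<open>d\<close> on, with the topology of pointwise convergence.  All indices start at 0.
\<close>

definition pd :: "nat \<Rightarrow> ((nat \<Rightarrow> real) \<Rightarrow> 'b::real_normed_vector) \<Rightarrow> (nat \<Rightarrow> real) \<Rightarrow> 'b" where
  "pd i f v = vector_derivative (\<lambda>t. f (v(i := t))) (at (v i))"

primrec Ck_on :: "nat \<Rightarrow> nat \<Rightarrow> (nat \<Rightarrow> real) set \<Rightarrow> ((nat \<Rightarrow> real) \<Rightarrow> 'b::real_normed_vector) \<Rightarrow> bool" where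
  "Ck_on 0 d U f \<longleftrightarrow> continuous_map (subtopology (Euclidean_space d) U) euclidean f"
| "Ck_on (Suc k) d U f \<longleftrightarrow> continuous_map (subtopology (Euclidean_space d) U) euclidean f \<and>
     (\<forall>i<d. (\<forall>v\<in>U. (\<lambda>t. f (v(i := t))) differentiable (at (v i))) \<and> Ck_on k d U (pd i f))"

definition smooth_on :: "nat \<Rightarrow> (nat \<Rightarrow> real) set \<Rightarrow> ((nat \<Rightarrow> real) \<Rightarrow> 'b::real_normed_vector) \<Rightarrow> bool" where
  "smooth_on d U f \<longleftrightarrow> openin (Euclidean_space d) U \<and> (\<forall>k. Ck_on k d U f)"

text \<open>The multi-index derivative: \<open>\<alpha> 0\<close> times \<open>\<partial>\<^sub>0\<close> (outermost), \<open>\<alpha> 1\<close> times \<open>\<partial>\<^sub>1\<close>, and so on.\<close>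

definition mpd :: "nat \<Rightarrow> (nat \<Rightarrow> nat) \<Rightarrow> ((nat \<Rightarrow> real) \<Rightarrow> 'b::real_normed_vector) \<Rightarrow> (nat \<Rightarrow> real) \<Rightarrow> 'b" where
  "mpd d \<alpha> f = foldr (\<lambda>i. pd i ^^ \<alpha> i) [0..<d] f"

text \<open>\<open>Q\<close> is the Taylor polynomial of total degree \<open>m\<close> at \<open>p\<close> of a function \<open>F\<close> that is defined and
  smooth near \<open>p \<in> \<real>\<^sup>d\<close>.\<close>

definition is_taylor_polynomial ::
  "nat \<Rightarrow> nat \<Rightarrow> ((nat \<Rightarrow> real) \<Rightarrow> complex) \<Rightarrow> (nat \<Rightarrow> real) \<Rightarrow> ((nat \<Rightarrow> real) \<Rightarrow> complex) \<Rightarrow> bool" where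
  "is_taylor_polynomial m d F p Q \<longleftrightarrow>
     (\<exists>U. p \<in> U \<and> smooth_on d U F) \<and>
     (\<forall>y \<in> topspace (Euclidean_space d).
        Q y = (\<Sum>\<alpha> \<in> {\<alpha> \<in> {..<d} \<rightarrow>\<^sub>E UNIV. (\<Sum>i<d. \<alpha> i) \<le> m}.
                 mpd d \<alpha> F p / (\<Prod>i<d. fact (\<alpha> i)) * of_real (\<Prod>i<d. (y i - p i) ^ \<alpha> i)))"


section \<open>Smooth manifolds\<close>

type_synonym 'a chart = "'a set \<times> ('a \<Rightarrow> nat \<Rightarrow> real)"

record 'a mfd =
  mtop :: "'a topology"
  mdim :: nat
  atlas :: "'a chart set"

definition is_chart :: "'a topology \<Rightarrow> nat \<Rightarrow> 'a chart \<Rightarrow> bool" where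
  "is_chart T d c \<longleftrightarrow> (case c of (U, \<phi>) \<Rightarrow>
     openin T U \<and> openin (Euclidean_space d) (\<phi> ` U) \<and>
     homeomorphic_map (subtopology T U) (subtopology (Euclidean_space d) (\<phi> ` U)) \<phi>)"

definition in_chart :: "'a chart \<Rightarrow> ('a \<Rightarrow> 'b) \<Rightarrow> (nat \<Rightarrow> real) \<Rightarrow> 'b" where
  "in_chart c f v = f (inv_into (fst c) (snd c) v)"

definition transition_smooth :: "nat \<Rightarrow> 'a chart \<Rightarrow> 'a chart \<Rightarrow> bool" where
  "transition_smooth d c c' \<longleftrightarrow>
     (\<forall>i<d. smooth_on d (snd c ` (fst c \<inter> fst c')) (in_chart c (\<lambda>p. snd c' p i)))"

definition compatible :: "nat \<Rightarrow> 'a chart \<Rightarrow> 'a chart \<Rightarrow> bool" where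
  "compatible d c c' \<longleftrightarrow> transition_smooth d c c' \<and> transition_smooth d c' c"

definition maximal_atlas :: "'a mfd \<Rightarrow> 'a chart set" where
  "maximal_atlas M = {c. is_chart (mtop M) (mdim M) c \<and> (\<forall>c' \<in> atlas M. compatible (mdim M) c c')}"

text \<open>Neither Hausdorff nor second countable is included here: it is customary to allow the arrow space of
  a Lie groupoid to be non-Hausdorff (see \<open>lie_groupoid\<close> below).\<close>

definition smooth_mfd :: "'a mfd \<Rightarrow> bool" where
  "smooth_mfd M \<longleftrightarrow> atlas M \<subseteq> maximal_atlas M \<and> (\<Union>c \<in> atlas M. fst c) = topspace (mtop M)"

definition smooth_fun :: "'a mfd \<Rightarrow> ('a \<Rightarrow> complex) \<Rightarrow> bool" where
  "smooth_fun M f \<longleftrightarrow> (\<forall>p \<in> topspace (mtop M). \<exists>c \<in> atlas M.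
     p \<in> fst c \<and> smooth_on (mdim M) (snd c ` fst c) (in_chart c f))"

definition smooth_map :: "'a mfd \<Rightarrow> 'b mfd \<Rightarrow> ('a \<Rightarrow> 'b) \<Rightarrow> bool" where
  "smooth_map M N f \<longleftrightarrow> continuous_map (mtop M) (mtop N) f \<and>
     (\<forall>p \<in> topspace (mtop M). \<exists>c \<in> atlas M. \<exists>c' \<in> atlas N. p \<in> fst c \<and> f p \<in> fst c' \<and>
        (\<forall>i < mdim N. smooth_on (mdim M) (snd c ` (fst c \<inter> f -` fst c'))
                        (in_chart c (\<lambda>q. snd c' (f q) i))))"

text \<open>Submersion: the Jacobian matrix is surjective onto \<open>\<real>\<^bsup>mdim N\<^esup>\<close> at every point.\<close>

definition submersion :: "'a mfd \<Rightarrow> 'b mfd \<Rightarrow> ('a \<Rightarrow> 'b) \<Rightarrow> bool" where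
  "submersion M N f \<longleftrightarrow> smooth_map M N f \<and>
     (\<forall>p \<in> topspace (mtop M). \<forall>c \<in> atlas M. \<forall>c' \<in> atlas N. p \<in> fst c \<and> f p \<in> fst c' \<longrightarrow>
        (\<forall>w :: nat \<Rightarrow> real. \<exists>v :: nat \<Rightarrow> real. \<forall>i < mdim N.
           (\<Sum>j < mdim M. v j * pd j (in_chart c (\<lambda>q. snd c' (f q) i)) (snd c p)) = w i))"

text \<open>Product of charts of a \<open>d\<close>-dimensional manifold; points of the \<open>n\<close>-fold power are extensional
  functions on \<open>{..<n}\<close>, and the \<open>i\<close>-th coordinate of the \<open>a\<close>-th factor has index \<open>a * d + i\<close>.\<close>

definition power_chart :: "nat \<Rightarrow> nat \<Rightarrow> (nat \<Rightarrow> 'a chart) \<Rightarrow> (nat \<Rightarrow> 'a) chart" where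
  "power_chart n d c =
     (\<Pi>\<^sub>E a \<in> {..<n}. fst (c a),
      \<lambda>g k. if k < n * d then snd (c (k div d)) (g (k div d)) (k mod d) else 0)"

definition power_mfd :: "nat \<Rightarrow> 'a mfd \<Rightarrow> (nat \<Rightarrow> 'a) mfd" where
  "power_mfd n M =
     \<lparr> mtop = product_topology (\<lambda>_. mtop M) {..<n},
       mdim = n * mdim M,
       atlas = {power_chart n (mdim M) c | c. \<forall>a<n. c a \<in> atlas M} \<rparr>"

text \<open>Charts of the maximal atlas in which \<open>S\<close> is the coordinate slice \<open>\<real>\<^sup>k \<subseteq> \<real>\<^bsup>mdim M\<^esup>\<close>.
  Since \<open>\<real>\<^sup>k\<close> consists of sequences vanishing from \<open>k\<close> on, such a chart restricts to a chart of \<open>S\<close>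
  with values in \<open>\<real>\<^sup>k\<close> without further projection.\<close>

definition slice_charts :: "nat \<Rightarrow> 'a mfd \<Rightarrow> 'a set \<Rightarrow> 'a chart set" where
  "slice_charts k M S =
     {c \<in> maximal_atlas M. snd c ` (fst c \<inter> S) = snd c ` fst c \<inter> topspace (Euclidean_space k)}"

definition embedded_submfd :: "nat \<Rightarrow> 'a mfd \<Rightarrow> 'a set \<Rightarrow> bool" where
  "embedded_submfd k M S \<longleftrightarrow> k \<le> mdim M \<and> S \<subseteq> topspace (mtop M) \<and>
     (\<forall>p \<in> S. \<exists>c \<in> slice_charts k M S. p \<in> fst c)"

text \<open>The induced smooth structure of a \<open>k\<close>-dimensional embedded submanifold.\<close>

definition submfd :: "nat \<Rightarrow> 'a mfd \<Rightarrow> 'a set \<Rightarrow> 'a mfd" where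
  "submfd k M S =
     \<lparr> mtop = subtopology (mtop M) S,
       mdim = k,
       atlas = {(fst c \<inter> S, snd c) | c. c \<in> slice_charts k M S} \<rparr>"

text \<open>A tangent vector at \<open>p\<close> is represented by the directional derivative
  \<open>f \<mapsto> \<Sum>i. a\<^sub>i (\<partial>f/\<partial>y\<^sup>i)(p)\<close> of functions smooth near \<open>p\<close>, in any chart around \<open>p\<close>.\<close>

type_synonym 'a tangent = "('a \<Rightarrow> complex) \<Rightarrow> complex"

definition coord_vector :: "'a chart \<Rightarrow> 'a \<Rightarrow> nat \<Rightarrow> 'a tangent" where
  "coord_vector c p i = (\<lambda>f. pd i (in_chart c f) (snd c p))"

definition tangent_space :: "'a mfd \<Rightarrow> 'a \<Rightarrow> 'a tangent set" where
  "tangent_space M p =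
     {(\<lambda>f. \<Sum>i < mdim M. of_real (a i) * coord_vector c p i f) | (a :: nat \<Rightarrow> real) c.
        c \<in> maximal_atlas M \<and> p \<in> fst c}"

lemma coord_vector_tangent:
  assumes "c \<in> maximal_atlas M" "p \<in> fst c" "i < mdim M"
  shows "coord_vector c p i \<in> tangent_space M p"
proof -
  let ?a = "\<lambda>j. if j = i then 1 else 0 :: real"
  have "(\<Sum>j < mdim M. of_real (?a j) * coord_vector c p j f) = coord_vector c p i f" for f
  proof -
    have "(\<Sum>j < mdim M. of_real (?a j) * coord_vector c p j f) =
          (\<Sum>j < mdim M. if j = i then coord_vector c p j f else 0)"
      by (intro sum.cong) auto
    also have "\<dots> = coord_vector c p i f"
      using assms(3) by (simp add: sum.delta')
    finally show ?thesis .
  qed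
  hence *: "coord_vector c p i = (\<lambda>f. \<Sum>j < mdim M. of_real (?a j) * coord_vector c p j f)"
    by auto
  show ?thesis
    unfolding tangent_space_def mem_Collect_eq
    by (rule exI [of _ ?a], rule exI [of _ c]) (use * assms(1,2) in simp)
qed


section \<open>Lie groupoids\<close>

text \<open>The product \<open>mult G g h\<close> is defined when \<open>tgt G g = src G h\<close>.\<close>

record ('g, 'x) groupoid =
  arrows :: "'g mfd"
  objects :: "'x mfd"
  src :: "'g \<Rightarrow> 'x"
  tgt :: "'g \<Rightarrow> 'x"
  ident :: "'x \<Rightarrow> 'g"
  mult :: "'g \<Rightarrow> 'g \<Rightarrow> 'g"
  inverse_arrow :: "'g \<Rightarrow> 'g"

abbreviation Arr :: "('g, 'x) groupoid \<Rightarrow> 'g set" where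
  "Arr G \<equiv> topspace (mtop (arrows G))"

abbreviation Obj :: "('g, 'x) groupoid \<Rightarrow> 'x set" where
  "Obj G \<equiv> topspace (mtop (objects G))"

definition is_groupoid :: "('g, 'x) groupoid \<Rightarrow> bool" where
  "is_groupoid G \<longleftrightarrow>
     (\<forall>g \<in> Arr G. src G g \<in> Obj G \<and> tgt G g \<in> Obj G) \<and>
     (\<forall>x \<in> Obj G. ident G x \<in> Arr G \<and> src G (ident G x) = x \<and> tgt G (ident G x) = x) \<and>
     (\<forall>g \<in> Arr G. \<forall>h \<in> Arr G. tgt G g = src G h \<longrightarrow>
        mult G g h \<in> Arr G \<and> src G (mult G g h) = src G g \<and> tgt G (mult G g h) = tgt G h) \<and>
     (\<forall>g \<in> Arr G. \<forall>h \<in> Arr G. \<forall>k \<in> Arr G. tgt G g = src G h \<and> tgt G h = src G k \<longrightarrow>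
        mult G (mult G g h) k = mult G g (mult G h k)) \<and>
     (\<forall>g \<in> Arr G. mult G (ident G (src G g)) g = g \<and> mult G g (ident G (tgt G g)) = g) \<and>
     (\<forall>g \<in> Arr G. inverse_arrow G g \<in> Arr G \<and>
        src G (inverse_arrow G g) = tgt G g \<and> tgt G (inverse_arrow G g) = src G g \<and>
        mult G g (inverse_arrow G g) = ident G (src G g) \<and>
        mult G (inverse_arrow G g) g = ident G (tgt G g))"

text \<open>The space of composable pairs, an embedded submanifold of codimension \<open>dim X\<close> of the
  square of the arrow manifold, where \<open>X\<close> is the object manifold.\<close>

definition composable_pairs :: "('g, 'x) groupoid \<Rightarrow> (nat \<Rightarrow> 'g) mfd" where
  "composable_pairs G =
     submfd (2 * mdim (arrows G) - mdim (objects G)) (power_mfd 2 (arrows G))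
       {g \<in> {..<2} \<rightarrow>\<^sub>E Arr G. tgt G (g 0) = src G (g 1)}"

definition lie_groupoid :: "('g, 'x) groupoid \<Rightarrow> bool" where
  "lie_groupoid G \<longleftrightarrow>
     is_groupoid G \<and>
     smooth_mfd (arrows G) \<and>
     smooth_mfd (objects G) \<and> Hausdorff_space (mtop (objects G)) \<and> second_countable (mtop (objects G)) \<and>
     submersion (arrows G) (objects G) (src G) \<and>
     submersion (arrows G) (objects G) (tgt G) \<and>
     smooth_map (objects G) (arrows G) (ident G) \<and>
     smooth_map (arrows G) (arrows G) (inverse_arrow G) \<and>
     smooth_map (composable_pairs G) (arrows G) (\<lambda>g. mult G (g 0) (g 1))"

definition src_fiber :: "('g, 'x) groupoid \<Rightarrow> 'x \<Rightarrow> 'g set" where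
  "src_fiber G x = {g \<in> Arr G. src G g = x}"

text \<open>All source fibers are \<open>n\<close>-dimensional (embedded) submanifolds.  As the source map is a submersion, they
  are automatically embedded, of dimension \<open>mdim (arrows G) - mdim (objects G)\<close>.\<close>

definition src_fibers_dim :: "nat \<Rightarrow> ('g, 'x) groupoid \<Rightarrow> bool" where
  "src_fibers_dim n G \<longleftrightarrow> (\<forall>x \<in> Obj G. embedded_submfd n (arrows G) (src_fiber G x))"

definition src_fiber_mfd :: "nat \<Rightarrow> ('g, 'x) groupoid \<Rightarrow> 'x \<Rightarrow> 'g mfd" where
  "src_fiber_mfd n G x = submfd n (arrows G) (src_fiber G x)"

definition lie_algebroid_fiber :: "nat \<Rightarrow> ('g, 'x) groupoid \<Rightarrow> 'x \<Rightarrow> 'g tangent set" where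
  "lie_algebroid_fiber n G x = tangent_space (src_fiber_mfd n G x) (ident G x)"


section \<open>Cochains and the van Est map\<close>

text \<open>Throughout, \<open>n \<ge> 1\<close>.  The set \<open>G\<^bsup>(n)\<^esup>\<close> is an iterated fiber product of source maps, hence an embedded
  submanifold of the \<open>n\<close>-fold power of the arrow manifold, of dimension \<open>dim X + n (dim G - dim X)\<close>.\<close>

definition nerve :: "nat \<Rightarrow> ('g, 'x) groupoid \<Rightarrow> (nat \<Rightarrow> 'g) set" where
  "nerve n G = {g \<in> {..<n} \<rightarrow>\<^sub>E Arr G. \<forall>a<n. \<forall>b<n. src G (g a) = src G (g b)}"

definition nerve_mfd :: "nat \<Rightarrow> ('g, 'x) groupoid \<Rightarrow> (nat \<Rightarrow> 'g) mfd" where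
  "nerve_mfd n G =
     submfd (mdim (objects G) + n * (mdim (arrows G) - mdim (objects G))) (power_mfd n (arrows G)) (nerve n G)"

definition cochain :: "nat \<Rightarrow> ('g, 'x) groupoid \<Rightarrow> ((nat \<Rightarrow> 'g) \<Rightarrow> complex) \<Rightarrow> bool" where
  "cochain n G \<Omega> \<longleftrightarrow> smooth_fun (nerve_mfd n G) \<Omega>"

definition normalized :: "nat \<Rightarrow> ('g, 'x) groupoid \<Rightarrow> ((nat \<Rightarrow> 'g) \<Rightarrow> complex) \<Rightarrow> bool" where
  "normalized n G \<Omega> \<longleftrightarrow> (\<forall>g \<in> nerve n G. (\<exists>a<n. g a \<in> ident G ` Obj G) \<longrightarrow> \<Omega> g = 0)"

definition permute_args :: "nat \<Rightarrow> (nat \<Rightarrow> nat) \<Rightarrow> (nat \<Rightarrow> 'g) \<Rightarrow> nat \<Rightarrow> 'g" where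
  "permute_args n \<sigma> g = (\<lambda>a\<in>{..<n}. g (\<sigma> a))"

definition antisymmetric_cochain :: "nat \<Rightarrow> ('g, 'x) groupoid \<Rightarrow> ((nat \<Rightarrow> 'g) \<Rightarrow> complex) \<Rightarrow> bool" where
  "antisymmetric_cochain n G \<Omega> \<longleftrightarrow>
     (\<forall>\<sigma>. \<sigma> permutes {..<n} \<longrightarrow> (\<forall>g \<in> nerve n G. \<Omega> (permute_args n \<sigma> g) = of_int (sign \<sigma>) * \<Omega> g))"

definition Alt :: "nat \<Rightarrow> ((nat \<Rightarrow> 'g) \<Rightarrow> complex) \<Rightarrow> (nat \<Rightarrow> 'g) \<Rightarrow> complex" where
  "Alt n \<Omega> g = 1 / fact n * (\<Sum>\<sigma> | \<sigma> permutes {..<n}. of_int (sign \<sigma>) * \<Omega> (permute_args n \<sigma> g))"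

text \<open>\<open>V\<close>, a tangent vector at the identity arrow, differentiates the \<open>a\<close>-th argument there; the result no longer
  depends on \<open>g a\<close>.\<close>

definition apply_slot :: "nat \<Rightarrow> 'g tangent \<Rightarrow> ((nat \<Rightarrow> 'g) \<Rightarrow> complex) \<Rightarrow> (nat \<Rightarrow> 'g) \<Rightarrow> complex" where
  "apply_slot a V F g = V (\<lambda>h. F (g(a := h)))"

definition ident_tuple :: "nat \<Rightarrow> ('g, 'x) groupoid \<Rightarrow> 'x \<Rightarrow> nat \<Rightarrow> 'g" where
  "ident_tuple n G x = (\<lambda>a\<in>{..<n}. ident G x)"

text \<open>The van Est map at \<open>x\<close>, for \<open>V 0, \<dots>, V (n - 1)\<close> in the fiber of the Lie algebroid at \<open>x\<close>.\<close>

definition VE :: "nat \<Rightarrow> ('g, 'x) groupoid \<Rightarrow> ((nat \<Rightarrow> 'g) \<Rightarrow> complex) \<Rightarrow> 'x \<Rightarrow> (nat \<Rightarrow> 'g tangent) \<Rightarrow> complex" where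
  "VE n G \<Omega> x V =
     fact n * foldr (\<lambda>a. apply_slot a (V a)) [0..<n] (Alt n \<Omega>) (ident_tuple n G x)"

text \<open>The determinant of the vectors \<open>y\<^sub>a - x\<close>, where \<open>y\<^sub>a\<close> has the components \<open>y (a * n + i)\<close>, \<open>i < n\<close>.\<close>

definition Vol_Delta :: "nat \<Rightarrow> (nat \<Rightarrow> real) \<Rightarrow> (nat \<Rightarrow> real) \<Rightarrow> real" where
  "Vol_Delta n x y = Determinant.det (Matrix.mat n n (\<lambda>(a, i). y (a * n + i) - x i))"

lemma coord_vector_lie_algebroid_fiber:
  assumes "c \<in> maximal_atlas (src_fiber_mfd n G x)" "ident G x \<in> fst c" "i < n"
  shows "coord_vector c (ident G x) i \<in> lie_algebroid_fiber n G x"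
  unfolding lie_algebroid_fiber_def
  by (rule coord_vector_tangent) (use assms in \<open>auto simp: src_fiber_mfd_def submfd_def\<close>)

end

theory Submission
  imports Defs
begin

text \<open>
  Write \<open>F (y\<^sub>0, \<dots>, y\<^sub>n\<^sub>-\<^sub>1)\<close> for \<open>\<Omega>\<close> in the coordinates of the source fiber, a smooth function of \<open>n\<close> vectors in
  \<open>\<real>\<^sup>n\<close>, and \<open>q\<close> for the coordinates of the identity arrow. As \<open>\<Omega>\<close> is normalized, \<open>F\<close> vanishes as soon as one
  \<open>y\<^sub>a\<close> is \<open>q\<close>, so a partial derivative of \<open>F\<close> at \<open>(q, \<dots>, q)\<close> is zero if it does not differentiate in every
  \<open>y\<^sub>a\<close>. Up to order \<open>n\<close> this leaves the derivatives \<open>D\<^sub>\<tau>\<close> that differentiate once in each \<open>y\<^sub>a\<close>, along its coordinate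
  \<open>\<tau> a\<close>. By antisymmetry \<open>D\<^sub>\<tau>\<close> is zero unless \<open>\<tau>\<close> is a permutation, and then \<open>D\<^sub>\<tau> = sign \<tau> D\<^sub>i\<^sub>d\<close>. The Taylor
  polynomial is therefore \<open>D\<^sub>i\<^sub>d\<close> times the Leibniz expansion of the determinant of the vectors \<open>y\<^sub>a - q\<close>
  (\<open>antisymmetric_block_function.taylor_polynomial\<close>). Since \<open>Alt \<Omega> = \<Omega>\<close>, the van Est map yields \<open>n! D\<^sub>i\<^sub>d\<close>
  (\<open>slots_eq_pds\<close>).

  The transformation of \<open>D\<^sub>\<tau>\<close> under permutations does not go through the symmetry of mixed partial
  derivatives. As \<open>F\<close> vanishes when an argument is \<open>q\<close>, \<open>D\<^sub>\<tau>\<close> is the limit of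
  \<open>F (q + h e\<^sub>\<tau>\<^sub>0, \<dots>, q + h e\<^sub>\<tau>\<^sub>(\<^sub>n\<^sub>-\<^sub>1\<^sub>)) / h\<^sup>n\<close> as \<open>h\<close> tends to 0 from the right (\<open>iterated_difference_limit\<close>), and
  antisymmetry passes to the limit (\<open>slot_derivative_permute\<close>).

  It remains to see that \<open>F\<close> is smooth near \<open>(q, \<dots>, q)\<close> (\<open>smooth_near_diagonal\<close>). Smoothness of a cochain is
  expressed in charts of the nerve as a submanifold of a power of the arrow manifold, so this takes a
  chain of changes of charts and the stability of smoothness under composition (\<open>Ck_on_compose\<close>), which
  rests on the total differentiability of continuously partially differentiable functions
  (\<open>Ck_on_linear_estimate\<close>).
\<close>

section \<open>Differentiable functions on open sets of sequences\<close>

text \<open>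
  The open boxes \<open>ebox d p r\<close>, of half-width \<open>r\<close> around \<open>p\<close>, form a neighbourhood base of \<open>p\<close>
  in \<open>\<real>\<^sup>d\<close>. They are stable under replacing some coordinates of one point by those of another, which is
  what arguments that change one coordinate at a time need.
\<close>

definition ebox :: "nat \<Rightarrow> (nat \<Rightarrow> real) \<Rightarrow> real \<Rightarrow> (nat \<Rightarrow> real) set" where
  "ebox d p r = {v. (\<forall>i<d. \<bar>v i - p i\<bar> < r) \<and> (\<forall>i\<ge>d. v i = 0)}"

lemma openin_Euclidean_space_subset:
  assumes "openin (Euclidean_space d) U" "v \<in> U"
  shows "\<forall>i\<ge>d. v i = 0"
  using openin_subset[OF assms(1)] assms(2) by (auto simp: topspace_Euclidean_space)

lemma ebox_mono: "r \<le> s \<Longrightarrow> ebox d v r \<subseteq> ebox d v s"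
  by (auto simp: ebox_def)

lemma openin_contains_ebox:
  assumes "openin (Euclidean_space d) U" "v \<in> U"
  obtains r where "r > 0" "ebox d v r \<subseteq> U"
proof -
  obtain T where T: "open T" "U = T \<inter> {x. \<forall>i\<ge>d. x i = 0}"
    using assms(1) unfolding Euclidean_space_def openin_subtopology euclidean_product_topology
    by auto
  have "openin (product_topology (\<lambda>i. euclidean) UNIV) T" "v \<in> T"
    using T assms(2) by (auto simp: euclidean_product_topology)
  from product_topology_open_contains_basis[OF this]
  obtain X where X: "v \<in> Pi\<^sub>E UNIV X" "\<And>i. open (X i)" "Pi\<^sub>E UNIV X \<subseteq> T" by auto
  have "\<forall>\<^sub>F r in at_right 0. \<forall>i\<in>{..<d}. ball (v i) r \<subseteq> X i"
  proof (rule eventually_ball_finite; intro ballI finite_lessThan)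
    fix i
    have "v i \<in> X i" using X(1) by auto
    with X(2)[of i] obtain e where e: "e > 0" "ball (v i) e \<subseteq> X i"
      by (meson openE)
    show "\<forall>\<^sub>F r in at_right 0. ball (v i) r \<subseteq> X i"
      unfolding eventually_at_right_field
      by (rule exI[of _ e]) (use e in \<open>auto simp: subset_eq\<close>)
  qed
  moreover have "\<forall>\<^sub>F r in at_right (0::real). r > 0"
    by (simp add: eventually_at_right_less)
  ultimately have "\<exists>r>0. \<forall>i\<in>{..<d}. ball (v i) r \<subseteq> X i"
    using eventually_happens[OF eventually_conj] trivial_limit_at_right_real by blast
  then obtain r where r: "r > 0" "\<And>i. i < d \<Longrightarrow> ball (v i) r \<subseteq> X i" by auto
  have "ebox d v r \<subseteq> U"
  proof
    fix w assume w: "w \<in> ebox d v r"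
    have "w i \<in> X i" for i
    proof (cases "i < d")
      case True
      then show ?thesis using r(2)[OF True] w by (auto simp: ebox_def dist_real_def abs_minus_commute)
    next
      case False
      have "v i = w i" using w openin_Euclidean_space_subset[OF assms] False by (auto simp: ebox_def)
      moreover have "v i \<in> X i" using X(1) by auto
      ultimately show ?thesis by simp
    qed
    then have "w \<in> T" using X(3) by auto
    then show "w \<in> U" using T w by (auto simp: ebox_def)
  qed
  with r(1) show ?thesis by (rule that)
qed

lemma continuous_map_ebox:
  fixes f :: "(nat \<Rightarrow> real) \<Rightarrow> 'b::real_normed_vector"
  assumes f: "continuous_map (subtopology (Euclidean_space d) U) euclidean f"
    and U: "openin (Euclidean_space d) U" "v \<in> U" and "e > 0"
  obtains r where "r > 0" "ebox d v r \<subseteq> U" "\<And>w. w \<in> ebox d v r \<Longrightarrow> norm (f w - f v) < e"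
proof -
  have top: "topspace (subtopology (Euclidean_space d) U) = U"
    using openin_subset[OF U(1)] by auto
  have "openin (subtopology (Euclidean_space d) U) {w \<in> U. f w \<in> ball (f v) e}"
    using openin_continuous_map_preimage[OF f, of "ball (f v) e"] unfolding top by simp
  then have "openin (Euclidean_space d) {w \<in> U. f w \<in> ball (f v) e}"
    using U(1) openin_open_subtopology by blast
  moreover have "v \<in> {w \<in> U. f w \<in> ball (f v) e}" using U \<open>e > 0\<close> by simp
  ultimately obtain r where "r > 0" "ebox d v r \<subseteq> {w \<in> U. f w \<in> ball (f v) e}"
    by (rule openin_contains_ebox)
  then show ?thesis by (intro that[of r]) (auto simp: dist_norm norm_minus_commute)
qed

lemma eventually_line_in:
  assumes "openin (Euclidean_space d) U" "v \<in> U" "i < d"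
  shows "\<forall>\<^sub>F t in nhds (v i). v(i := t) \<in> U"
proof -
  obtain r where r: "r > 0" "ebox d v r \<subseteq> U" using openin_contains_ebox assms by blast
  have "\<forall>\<^sub>F t in nhds (v i). t \<in> ball (v i) r"
    using r by (intro eventually_nhds_in_open) auto
  then show ?thesis
  proof eventually_elim
    case (elim t)
    have "v(i := t) \<in> ebox d v r"
      using elim r(1) assms(3) openin_Euclidean_space_subset[OF assms(1,2)]
      by (auto simp: ebox_def dist_real_def abs_minus_commute)
    then show ?case using r by auto
  qed
qed

text \<open>
  \<open>has_pd i f v D\<close>: the \<open>i\<close>-th partial derivative of \<open>f\<close> at \<open>v\<close> exists and equals \<open>D\<close>. Unlike an
  equation \<open>pd i f v = D\<close>, it also asserts existence.
\<close>

abbreviation has_pd :: "nat \<Rightarrow> ((nat \<Rightarrow> real) \<Rightarrow> 'b::real_normed_vector) \<Rightarrow> (nat \<Rightarrow> real) \<Rightarrow> 'b \<Rightarrow> bool" where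
  "has_pd i f v D \<equiv> ((\<lambda>t. f (v(i := t))) has_vector_derivative D) (at (v i))"

lemma has_pd_imp_pd: "has_pd i f v D \<Longrightarrow> pd i f v = D"
  unfolding pd_def by (rule vector_derivative_at)

lemma differentiable_has_pd:
  "(\<lambda>t. f (v(i := t))) differentiable (at (v i)) \<longleftrightarrow> has_pd i f v (pd i f v)"
  unfolding pd_def by (rule vector_derivative_works)

lemma pd_cong_eventually:
  assumes "\<forall>\<^sub>F t in nhds (v i). f (v(i := t)) = g (v(i := t))"
  shows "pd i f v = pd i g v"
  unfolding pd_def by (rule vector_derivative_cong_eq) (use assms in auto)

lemma pd_cong:
  assumes "openin (Euclidean_space d) U" "v \<in> U" "i < d" "\<And>w. w \<in> U \<Longrightarrow> f w = g w"
  shows "pd i f v = pd i g v"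
  by (rule pd_cong_eventually) (use eventually_line_in[OF assms(1-3)] assms(4) in \<open>auto elim: eventually_mono\<close>)

lemma has_pd_cong:
  assumes "openin (Euclidean_space d) U" "v \<in> U" "i < d" "\<And>w. w \<in> U \<Longrightarrow> f w = g w"
    and "has_pd i f v D"
  shows "has_pd i g v D"
proof -
  have "\<forall>\<^sub>F t in nhds (v i). t \<in> UNIV \<longrightarrow> f (v(i := t)) = g (v(i := t))"
    using eventually_line_in[OF assms(1-3)] assms(4) by (auto elim: eventually_mono)
  then show ?thesis using assms(5) assms(4)[OF assms(2)]
    by (subst has_vector_derivative_cong_ev[symmetric, where f = "\<lambda>t. f (v(i := t))"]) auto
qed

lemma Ck_on_SucD:
  assumes "Ck_on (Suc k) d U f" "i < d"
  shows "Ck_on k d U (pd i f)" "\<And>v. v \<in> U \<Longrightarrow> has_pd i f v (pd i f v)"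
  using assms by (auto simp: differentiable_has_pd)

lemma Ck_on_continuous:
  "Ck_on k d U f \<Longrightarrow> continuous_map (subtopology (Euclidean_space d) U) euclidean f"
  by (cases k) auto

lemma Ck_on_cong:
  assumes "openin (Euclidean_space d) U" "\<And>v. v \<in> U \<Longrightarrow> f v = g v" "Ck_on k d U f"
  shows "Ck_on k d U g"
  using assms(2,3)
proof (induction k arbitrary: f g)
  case 0
  then show ?case by (auto intro: continuous_map_eq)
next
  case (Suc k)
  have "continuous_map (subtopology (Euclidean_space d) U) euclidean g"
    using Suc.prems by (auto intro: continuous_map_eq)
  moreover have "has_pd i g v (pd i g v)" if "i < d" "v \<in> U" for i v
  proof -
    have "has_pd i g v (pd i f v)"
      by (rule has_pd_cong[OF assms(1) that(2,1) Suc.prems(1) Ck_on_SucD(2)[OF Suc.prems(2) that]])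
    then show ?thesis unfolding has_pd_imp_pd[OF \<open>has_pd i g v (pd i f v)\<close>] .
  qed
  moreover have "Ck_on k d U (pd i g)" if "i < d" for i
    by (rule Suc.IH[OF _ Ck_on_SucD(1)[OF Suc.prems(2) that]])
      (rule pd_cong[OF assms(1) _ that Suc.prems(1)])
  ultimately show ?case by (simp add: differentiable_has_pd)
qed

lemma Ck_on_SucI:
  assumes "openin (Euclidean_space d) U"
    and "continuous_map (subtopology (Euclidean_space d) U) euclidean f"
    and "\<And>i v. i < d \<Longrightarrow> v \<in> U \<Longrightarrow> has_pd i f v (g i v)"
    and "\<And>i. i < d \<Longrightarrow> Ck_on k d U (g i)"
  shows "Ck_on (Suc k) d U f"
proof -
  have eq: "g i v = pd i f v" if "i < d" "v \<in> U" for i v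
    by (rule has_pd_imp_pd[OF assms(3)[OF that], symmetric])
  show ?thesis
    unfolding Ck_on.simps differentiable_has_pd
  proof (intro conjI allI impI ballI assms(2))
    fix i assume i: "i < d"
    show "has_pd i f v (pd i f v)" if "v \<in> U" for v
      using assms(3)[OF i that] unfolding eq[OF i that] .
    show "Ck_on k d U (pd i f)"
      by (rule Ck_on_cong[OF assms(1) eq[OF i] assms(4)[OF i]])
  qed
qed

lemma Ck_on_Suc_imp: "Ck_on (Suc k) d U f \<Longrightarrow> Ck_on k d U f"
proof (induction k arbitrary: f)
  case (Suc k)
  then show ?case by (metis Ck_on.simps(2))
qed auto

lemma Ck_on_const: "openin (Euclidean_space d) U \<Longrightarrow> Ck_on k d U (\<lambda>v. z)"
proof (induction k arbitrary: z)
  case (Suc k)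
  show ?case by (rule Ck_on_SucI[where g = "\<lambda>i v. 0"]) (use Suc in auto)
qed auto

lemma Ck_on_coordinate:
  assumes "openin (Euclidean_space d) U"
  shows "Ck_on k d U (\<lambda>v. v j)"
proof -
  have c: "continuous_map (subtopology (Euclidean_space d) U) euclidean (\<lambda>v. v j)"
    unfolding Euclidean_space_def
    by (intro continuous_map_from_subtopology continuous_map_product_projection) auto
  show ?thesis
  proof (cases k)
    case 0
    with c show ?thesis by simp
  next
    case (Suc k')
    have "has_pd i (\<lambda>v. v j) v (if i = j then 1 else 0)" for i and v :: "nat \<Rightarrow> real"
      by (cases "i = j") (auto intro!: derivative_eq_intros)
    then show ?thesis unfolding Suc
      by (intro Ck_on_SucI[OF assms c, where g = "\<lambda>i v. if i = j then 1 else 0"] Ck_on_const assms)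
  qed
qed

lemma Ck_on_add:
  assumes "openin (Euclidean_space d) U" "Ck_on k d U f" "Ck_on k d U g"
  shows "Ck_on k d U (\<lambda>v. f v + g v)"
  using assms(2,3)
proof (induction k arbitrary: f g)
  case 0
  then show ?case by (auto intro: continuous_map_add)
next
  case (Suc k)
  show ?case
    by (rule Ck_on_SucI[where g = "\<lambda>i v. pd i f v + pd i g v"])
      (use assms(1) Ck_on_SucD[OF Suc.prems(1)] Ck_on_SucD[OF Suc.prems(2)]
          Suc.prems[THEN Ck_on_continuous] in
        \<open>auto intro: continuous_map_add has_vector_derivative_add Suc.IH simp del: fun_upd_apply\<close>)
qed

lemma Ck_on_sum:
  assumes "openin (Euclidean_space d) U" "\<And>a. a \<in> A \<Longrightarrow> Ck_on k d U (f a)"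
  shows "Ck_on k d U (\<lambda>v. \<Sum>a\<in>A. f a v)"
  using assms(2)
  by (induction A rule: infinite_finite_induct) (auto intro: Ck_on_const Ck_on_add assms(1))

lemma Ck_on_scaleR:
  assumes "openin (Euclidean_space d) U" "Ck_on k d U f" "Ck_on k d U g"
  shows "Ck_on k d U (\<lambda>v. f v *\<^sub>R g v)"
  using assms(2,3)
proof (induction k arbitrary: f g)
  case 0
  then show ?case by (auto simp: continuous_map_atin intro: tendsto_scaleR)
next
  case (Suc k)
  show ?case
  proof (rule Ck_on_SucI[where g = "\<lambda>i v. f v *\<^sub>R pd i g v + pd i f v *\<^sub>R g v"])
    show "continuous_map (subtopology (Euclidean_space d) U) euclidean (\<lambda>v. f v *\<^sub>R g v)"
      using Suc.prems by (auto simp: continuous_map_atin intro: tendsto_scaleR)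
    fix i assume i: "i < d"
    show "has_pd i (\<lambda>v. f v *\<^sub>R g v) v (f v *\<^sub>R pd i g v + pd i f v *\<^sub>R g v)" if "v \<in> U" for v
      using has_vector_derivative_scaleR[OF 
          Ck_on_SucD(2)[OF Suc.prems(1) i that, folded has_real_derivative_iff_has_vector_derivative]
          Ck_on_SucD(2)[OF Suc.prems(2) i that]] by (simp del: fun_upd_apply)
    show "Ck_on k d U (\<lambda>v. f v *\<^sub>R pd i g v + pd i f v *\<^sub>R g v)"
      by (intro Ck_on_add assms(1) Suc.IH Ck_on_SucD(1)[OF Suc.prems(1) i]
          Ck_on_SucD(1)[OF Suc.prems(2) i] Suc.prems[THEN Ck_on_Suc_imp])
  qed (fact assms(1))
qed

lemma norm_diff_le_segment:
  fixes h :: "real \<Rightarrow> 'b::real_normed_vector"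
  assumes "\<And>t. t \<in> closed_segment a b \<Longrightarrow> (h has_vector_derivative h' t) (at t)"
    and "\<And>t. t \<in> closed_segment a b \<Longrightarrow> norm (h' t) \<le> B"
  shows "norm (h b - h a) \<le> B * \<bar>b - a\<bar>"
proof -
  have "norm (h b - h a) \<le> B * norm (b - a)"
  proof (rule differentiable_bound[where S = "closed_segment a b" and f' = "\<lambda>t x. x *\<^sub>R h' t"])
    fix t assume t: "t \<in> closed_segment a b"
    show "(h has_derivative (\<lambda>x. x *\<^sub>R h' t)) (at t within closed_segment a b)"
      using assms(1)[OF t] unfolding has_vector_derivative_def by (rule has_derivative_at_withinI)
    show "onorm (\<lambda>x. x *\<^sub>R h' t) \<le> B"
      using assms(2)[OF t] by (intro onorm_le) (simp add: mult.commute[of B] mult_left_mono)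
  qed auto
  then show ?thesis by simp
qed

text \<open>
  A function with continuous partial derivatives is totally differentiable. The estimate uses the
  \<open>\<ell>\<^sup>1\<close>-norm, as \<^typ>\<open>nat \<Rightarrow> real\<close> carries no norm of its own.
\<close>

lemma Ck_on_linear_estimate:
  fixes f :: "(nat \<Rightarrow> real) \<Rightarrow> 'b::real_normed_vector"
  assumes U: "openin (Euclidean_space d) U" "q \<in> U" and f: "Ck_on 1 d U f" and "e > 0"
  obtains r where "r > 0" "ebox d q r \<subseteq> U"
    "\<And>w. w \<in> ebox d q r \<Longrightarrow>
       norm (f w - f q - (\<Sum>j<d. (w j - q j) *\<^sub>R pd j f q)) \<le> e * (\<Sum>j<d. \<bar>w j - q j\<bar>)"
proof -
  have "\<forall>j\<in>{..<d}. \<forall>\<^sub>F r in at_right 0. \<forall>w\<in>ebox d q r. norm (pd j f w - pd j f q) \<le> e"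
  proof
    fix j assume j: "j \<in> {..<d}"
    have "continuous_map (subtopology (Euclidean_space d) U) euclidean (pd j f)"
      using f j by auto
    from continuous_map_ebox[OF this U \<open>e > 0\<close>]
    obtain r where r: "r > 0" "\<And>w. w \<in> ebox d q r \<Longrightarrow> norm (pd j f w - pd j f q) < e" by metis
    show "\<forall>\<^sub>F r in at_right 0. \<forall>w\<in>ebox d q r. norm (pd j f w - pd j f q) \<le> e"
      unfolding eventually_at_right_field
      by (rule exI[of _ r]) (use r ebox_mono[of _ r d q] in \<open>meson less_imp_le subsetD\<close>)
  qed
  then have "\<forall>\<^sub>F r in at_right 0. \<forall>j\<in>{..<d}. \<forall>w\<in>ebox d q r. norm (pd j f w - pd j f q) \<le> e"
    by (rule eventually_ball_finite[OF finite_lessThan])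
  moreover obtain r0 where r0: "r0 > 0" "ebox d q r0 \<subseteq> U" using openin_contains_ebox U by blast
  have "\<forall>\<^sub>F r in at_right (0::real). r > 0 \<and> ebox d q r \<subseteq> U"
    unfolding eventually_at_right_field
    by (rule exI[of _ r0]) (use r0 ebox_mono[of _ r0 d q] in \<open>meson less_imp_le subset_trans\<close>)
  ultimately obtain r where r: "r > 0" "ebox d q r \<subseteq> U"
      "\<And>j w. j < d \<Longrightarrow> w \<in> ebox d q r \<Longrightarrow> norm (pd j f w - pd j f q) \<le> e"
    using eventually_happens[OF eventually_conj] trivial_limit_at_right_real
    by (metis (mono_tags, lifting) lessThan_iff)
  have q0: "\<forall>i\<ge>d. q i = 0" using openin_Euclidean_space_subset[OF U] .
  have "norm (f w - f q - (\<Sum>j<d. (w j - q j) *\<^sub>R pd j f q)) \<le> e * (\<Sum>j<d. \<bar>w j - q j\<bar>)"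
    if w: "w \<in> ebox d q r" for w
  proof -
    \<comment> \<open>Pass from \<open>q\<close> to \<open>w\<close> by changing one coordinate at a time.\<close>
    define m where "m j = (\<lambda>i. if i < j then w i else q i)" for j
    have est: "norm (f (m j) - f q - (\<Sum>i<j. (w i - q i) *\<^sub>R pd i f q)) \<le> e * (\<Sum>i<j. \<bar>w i - q i\<bar>)"
      if "j \<le> d" for j
      using that
    proof (induction j)
      case 0
      then show ?case by (simp add: m_def)
    next
      case (Suc j)
      let ?h = "\<lambda>t. f ((m j)(j := t)) - t *\<^sub>R pd j f q"
      have inbox: "(m j)(j := t) \<in> ebox d q r" if "t \<in> closed_segment (q j) (w j)" for t
      proof -
        have "\<bar>t - q j\<bar> \<le> \<bar>w j - q j\<bar>"
          using that by (auto simp: closed_segment_eq_real_ivl split: if_splits)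
        also have "\<bar>w j - q j\<bar> < r" using w Suc.prems by (auto simp: ebox_def)
        finally show ?thesis using w q0 r(1) Suc.prems by (auto simp: ebox_def m_def)
      qed
      have "norm (?h (w j) - ?h (q j)) \<le> e * \<bar>w j - q j\<bar>"
      proof (rule norm_diff_le_segment[where h' = "\<lambda>t. pd j f ((m j)(j := t)) - pd j f q"])
        fix t assume t: "t \<in> closed_segment (q j) (w j)"
        have "has_pd j f ((m j)(j := t)) (pd j f ((m j)(j := t)))"
        proof (rule Ck_on_SucD(2)[of 0])
          show "(m j)(j := t) \<in> U" using inbox[OF t] r(2) by (rule set_rev_mp)
        qed (use f Suc.prems in auto)
        then have "((\<lambda>t. f ((m j)(j := t))) has_vector_derivative pd j f ((m j)(j := t))) (at t)"
          by simp
        then show "(?h has_vector_derivative pd j f ((m j)(j := t)) - pd j f q) (at t)"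
          by (auto intro!: derivative_eq_intros)
        show "norm (pd j f ((m j)(j := t)) - pd j f q) \<le> e"
          using r(3)[OF _ inbox[OF t]] Suc.prems by auto
      qed
      moreover have "(m j)(j := w j) = m (Suc j)" "(m j)(j := q j) = m j"
        by (auto simp: m_def fun_eq_iff less_Suc_eq)
      ultimately have step: "norm (f (m (Suc j)) - f (m j) - (w j - q j) *\<^sub>R pd j f q) \<le> e * \<bar>w j - q j\<bar>"
        by (simp add: algebra_simps)
      have "f (m (Suc j)) - f q - (\<Sum>i<Suc j. (w i - q i) *\<^sub>R pd i f q) =
        (f (m j) - f q - (\<Sum>i<j. (w i - q i) *\<^sub>R pd i f q)) +
        (f (m (Suc j)) - f (m j) - (w j - q j) *\<^sub>R pd j f q)"
        by simp
      then show ?case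
        using norm_triangle_mono[OF Suc.IH[OF Suc_leD[OF Suc.prems]] step]
          by (simp only: sum.lessThan_Suc distrib_left)
    qed
    have "m d = w" using w q0 by (auto simp: m_def ebox_def fun_eq_iff)
    then show ?thesis using est[of d] by simp
  qed
  with r(1,2) show ?thesis by (rule that)
qed

lemma chain_rule_curve:
  fixes f :: "(nat \<Rightarrow> real) \<Rightarrow> 'b::real_normed_vector"
  assumes U: "openin (Euclidean_space d) U" and f: "Ck_on 1 d U f"
    and \<gamma>: "\<forall>\<^sub>F t in nhds s. \<gamma> t \<in> U"
    and \<gamma>': "\<And>j. j < d \<Longrightarrow> ((\<lambda>t. \<gamma> t j) has_real_derivative \<gamma>' j) (at s)"
  shows "((\<lambda>t. f (\<gamma> t)) has_vector_derivative (\<Sum>j<d. \<gamma>' j *\<^sub>R pd j f (\<gamma> s))) (at s)"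
proof -
  define q where "q = \<gamma> s"
  have q: "q \<in> U" using \<gamma> unfolding q_def by (rule eventually_nhds_x_imp_x)
  define R where "R t = f (\<gamma> t) - (\<Sum>j<d. \<gamma> t j *\<^sub>R pd j f q)" for t
  have Rdiff: "R t - R s = f (\<gamma> t) - f q - (\<Sum>j<d. (\<gamma> t j - q j) *\<^sub>R pd j f q)" for t
    by (simp add: R_def q_def sum_subtractf scaleR_diff_left)
  define M where "M = (\<Sum>j<d. \<bar>\<gamma>' j\<bar> + 1)"
  have M0: "M \<ge> 0" by (auto simp: M_def intro: sum_nonneg)
  have lip: "\<forall>\<^sub>F t in nhds s. \<bar>\<gamma> t j - q j\<bar> \<le> (\<bar>\<gamma>' j\<bar> + 1) * \<bar>t - s\<bar>" if j: "j < d" for j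
  proof -
    obtain dl where dl: "dl > 0" "\<And>t. \<bar>t - s\<bar> < dl \<Longrightarrow>
        \<bar>\<gamma> t j - \<gamma> s j - \<gamma>' j * (t - s)\<bar> \<le> 1 * \<bar>t - s\<bar>"
      using \<gamma>'[OF j, unfolded has_field_derivative_def has_derivative_at_alt,
          THEN conjunct2, rule_format, of 1] by auto
    have "\<forall>\<^sub>F t in nhds s. t \<in> ball s dl" using dl by (intro eventually_nhds_in_open) auto
    then show ?thesis
    proof eventually_elim
      case (elim t)
      have "\<bar>\<gamma> t j - q j\<bar> \<le> \<bar>\<gamma> t j - \<gamma> s j - \<gamma>' j * (t - s)\<bar> + \<bar>\<gamma>' j * (t - s)\<bar>"
        unfolding q_def by linarith
      also have "\<dots> \<le> \<bar>t - s\<bar> + \<bar>\<gamma>' j\<bar> * \<bar>t - s\<bar>"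
        using dl(2)[of t] elim by (simp add: abs_mult dist_real_def abs_minus_commute)
      finally show ?case by (simp add: algebra_simps)
    qed
  qed
  have "(R has_vector_derivative 0) (at s)"
    unfolding has_vector_derivative_def has_derivative_at_alt
  proof (intro conjI allI impI)
    fix e :: real assume e: "e > 0"
    obtain r where r: "r > 0" and est: "\<And>w. w \<in> ebox d q r \<Longrightarrow>
       norm (f w - f q - (\<Sum>j<d. (w j - q j) *\<^sub>R pd j f q)) \<le> e / (M + 1) * (\<Sum>j<d. \<bar>w j - q j\<bar>)"
      by (rule Ck_on_linear_estimate[OF U q f, of "e / (M + 1)"]) (use e M0 in auto)
    have "\<forall>\<^sub>F t in nhds s. \<forall>j\<in>{..<d}. \<bar>\<gamma> t j - q j\<bar> \<le> (\<bar>\<gamma>' j\<bar> + 1) * \<bar>t - s\<bar>"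
      using lip by (intro eventually_ball_finite) auto
    moreover have "\<forall>\<^sub>F t in nhds s. \<forall>j\<in>{..<d}. \<bar>\<gamma> t j - q j\<bar> < r"
    proof (intro eventually_ball_finite ballI finite_lessThan)
      fix j assume "j \<in> {..<d}"
      then have "isCont (\<lambda>t. \<gamma> t j) s" using \<gamma>' DERIV_isCont by blast
      then have "((\<lambda>t. \<gamma> t j) \<longlongrightarrow> \<gamma> s j) (nhds s)"
        unfolding isCont_def using tendsto_at_iff_tendsto_nhds[of "\<lambda>t. \<gamma> t j" s] by simp
      then show "\<forall>\<^sub>F t in nhds s. \<bar>\<gamma> t j - q j\<bar> < r"
        using r unfolding tendsto_iff dist_real_def q_def by blast
    qed
    ultimately have "\<forall>\<^sub>F t in nhds s. norm (R t - R s) \<le> e * \<bar>t - s\<bar>"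
      using \<gamma>
    proof eventually_elim
      case (elim t)
      have box: "\<gamma> t \<in> ebox d q r"
        using elim openin_Euclidean_space_subset[OF U elim(3)] by (auto simp: ebox_def)
      have "norm (R t - R s) \<le> e / (M + 1) * (\<Sum>j<d. \<bar>\<gamma> t j - q j\<bar>)"
        unfolding Rdiff by (rule est[OF box])
      also have "\<dots> \<le> e / (M + 1) * (\<Sum>j<d. (\<bar>\<gamma>' j\<bar> + 1) * \<bar>t - s\<bar>)"
        using elim e M0 by (intro mult_left_mono sum_mono) auto
      also have "\<dots> = (e * \<bar>t - s\<bar>) * (M / (M + 1))"
        unfolding sum_distrib_right[symmetric] M_def[symmetric] by simp
      also have "\<dots> \<le> (e * \<bar>t - s\<bar>) * 1"
        using M0 e by (intro mult_left_mono) auto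
      finally show ?case by simp
    qed
    then show "\<exists>dl>0. \<forall>y. norm (y - s) < dl \<longrightarrow>
        norm (R y - R s - (y - s) *\<^sub>R 0) \<le> e * norm (y - s)"
      by (auto simp: eventually_nhds_metric dist_real_def)
  qed (rule bounded_linear_scaleR_left)
  moreover have "((\<lambda>t. \<Sum>j<d. \<gamma> t j *\<^sub>R pd j f q) has_vector_derivative (\<Sum>j<d. \<gamma>' j *\<^sub>R pd j f q)) (at s)"
  proof (rule has_vector_derivative_sum)
    fix j assume "j \<in> {..<d}"
    then show "((\<lambda>t. \<gamma> t j *\<^sub>R pd j f q) has_vector_derivative \<gamma>' j *\<^sub>R pd j f q) (at s)"
      using has_vector_derivative_scaleR[OF \<gamma>' has_vector_derivative_const[of "pd j f q"], of j] by simp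
  qed
  ultimately have "((\<lambda>t. R t + (\<Sum>j<d. \<gamma> t j *\<^sub>R pd j f q)) has_vector_derivative
      0 + (\<Sum>j<d. \<gamma>' j *\<^sub>R pd j f q)) (at s)"
    by (rule has_vector_derivative_add)
  then show ?thesis by (simp add: R_def q_def)
qed

text \<open>
  By induction on \<open>k\<close>: the chain rule expresses each partial derivative of the composite through
  functions that are \<open>k\<close> times continuously differentiable.
\<close>

lemma Ck_on_compose:
  fixes f :: "(nat \<Rightarrow> real) \<Rightarrow> 'b::real_normed_vector"
  assumes U: "openin (Euclidean_space d) U" and W: "openin (Euclidean_space e) W"
    and \<phi>: "\<And>v. v \<in> U \<Longrightarrow> \<phi> v \<in> W"
    and "\<And>j. j < e \<Longrightarrow> Ck_on k d U (\<lambda>v. \<phi> v j)" and "Ck_on k e W f"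
  shows "Ck_on k d U (\<lambda>v. f (\<phi> v))"
proof -
  have cont: "continuous_map (subtopology (Euclidean_space d) U) euclidean (\<lambda>v. f (\<phi> v))"
    if "\<And>j. j < e \<Longrightarrow> continuous_map (subtopology (Euclidean_space d) U) euclidean (\<lambda>v. \<phi> v j)"
      "continuous_map (subtopology (Euclidean_space e) W) euclidean f" for f :: "(nat \<Rightarrow> real) \<Rightarrow> 'b"
  proof -
    have 0: "\<phi> v j = 0" if "v \<in> U" "j \<ge> e" for v j
      using openin_Euclidean_space_subset[OF W \<phi>[OF that(1)]] that(2) by auto
    have "continuous_map (subtopology (Euclidean_space d) U) euclidean (\<lambda>v. \<phi> v j)" for j
    proof (cases "j < e")
      case False
      have "continuous_map (subtopology (Euclidean_space d) U) euclideanreal (\<lambda>v. 0)" by simp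
      then show ?thesis
        by (rule continuous_map_eq) (use 0 False in auto)
    qed (rule that(1))
    then have "continuous_map (subtopology (Euclidean_space d) U) (powertop_real UNIV) \<phi>"
      by (simp add: continuous_map_componentwise_UNIV)
    then have "continuous_map (subtopology (Euclidean_space d) U) (subtopology (Euclidean_space e) W) \<phi>"
      using \<phi> 0 by (auto simp: Euclidean_space_def continuous_map_in_subtopology)
    then show ?thesis
      using continuous_map_compose[OF _ that(2)] by (simp add: o_def)
  qed
  show ?thesis
    using assms(4,5)
  proof (induction k arbitrary: f)
    case 0
    then show ?case using cont by simp
  next
    case (Suc k)
    have W1: "Ck_on 1 e W f" using Suc.prems(2) Ck_on_continuous[of k e W] by auto
    show ?case
    proof (rule Ck_on_SucI[OF U, where g = "\<lambda>i v. \<Sum>j<e. pd i (\<lambda>v. \<phi> v j) v *\<^sub>R pd j f (\<phi> v)"])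
      show "continuous_map (subtopology (Euclidean_space d) U) euclidean (\<lambda>v. f (\<phi> v))"
        using Suc.prems by (intro cont) auto
      fix i assume i: "i < d"
      show "has_pd i (\<lambda>v. f (\<phi> v)) v (\<Sum>j<e. pd i (\<lambda>v. \<phi> v j) v *\<^sub>R pd j f (\<phi> v))" if v: "v \<in> U" for v
      proof -
        have "\<forall>\<^sub>F t in nhds (v i). \<phi> (v(i := t)) \<in> W"
          using eventually_line_in[OF U v i] by (rule eventually_mono) (rule \<phi>)
        moreover have "((\<lambda>t. \<phi> (v(i := t)) j) has_real_derivative pd i (\<lambda>v. \<phi> v j) v) (at (v i))"
          if "j < e" for j
          using Ck_on_SucD(2)[OF Suc.prems(1)[OF that] i v]
          by (simp add: has_real_derivative_iff_has_vector_derivative del: fun_upd_apply)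
        ultimately show ?thesis
          using chain_rule_curve[OF W W1, where s = "v i" and \<gamma> = "\<lambda>t. \<phi> (v(i := t))"] by simp
      qed
      show "Ck_on k d U (\<lambda>v. \<Sum>j<e. pd i (\<lambda>v. \<phi> v j) v *\<^sub>R pd j f (\<phi> v))"
      proof (intro Ck_on_sum Ck_on_scaleR Suc.IH U)
        fix j assume j: "j \<in> {..<e}"
        show "Ck_on k d U (pd i (\<lambda>v. \<phi> v j))"
          by (rule Ck_on_SucD(1)[OF Suc.prems(1) i]) (use j in simp)
        show "Ck_on k e W (pd j f)"
          by (rule Ck_on_SucD(1)[OF Suc.prems(2)]) (use j in simp)
      qed (rule Suc.prems(1)[THEN Ck_on_Suc_imp])
    qed
  qed
qed

lemma smooth_on_compose:
  assumes "openin (Euclidean_space d) U" "\<And>v. v \<in> U \<Longrightarrow> \<phi> v \<in> W"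
    and "\<And>j. j < e \<Longrightarrow> smooth_on d U (\<lambda>v. \<phi> v j)" and "smooth_on e W f"
  shows "smooth_on d U (\<lambda>v. f (\<phi> v))"
  unfolding smooth_on_def
proof (intro conjI allI)
  fix k
  show "Ck_on k d U (\<lambda>v. f (\<phi> v))"
    by (rule Ck_on_compose[OF assms(1) _ assms(2), of e]) (use assms(3,4) in \<open>auto simp: smooth_on_def\<close>)
qed (fact assms(1))

lemma smooth_on_cong:
  assumes "smooth_on d U f" "\<And>v. v \<in> U \<Longrightarrow> f v = g v"
  shows "smooth_on d U g"
  using assms Ck_on_cong unfolding smooth_on_def by metis

lemma smooth_on_pd:
  assumes "smooth_on d U f" "i < d"
  shows "smooth_on d U (pd i f)"
  using assms Ck_on_SucD(1) unfolding smooth_on_def by metis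

lemma smooth_on_has_pd:
  assumes "smooth_on d U f" "i < d" "v \<in> U"
  shows "has_pd i f v (pd i f v)"
  using assms Ck_on_SucD(2) unfolding smooth_on_def by metis

section \<open>Vanishing on coordinate slices and iterated differences\<close>

text \<open>
  If \<open>f\<close> vanishes where the coordinates in \<open>I\<close> agree with those of \<open>p\<close>, then so do its derivatives in
  the directions outside \<open>I\<close>.
\<close>

lemma pd_vanishes_on_slice:
  fixes f :: "(nat \<Rightarrow> real) \<Rightarrow> 'b::real_normed_vector"
  assumes U: "openin (Euclidean_space d) U" and j: "j < d" "j \<notin> I"
    and f: "\<And>v. v \<in> U \<Longrightarrow> (\<forall>i\<in>I. v i = p i) \<Longrightarrow> f v = 0"
    and v: "v \<in> U" "\<forall>i\<in>I. v i = p i"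
  shows "pd j f v = 0"
proof -
  have "\<forall>\<^sub>F t in nhds (v j). f (v(j := t)) = (\<lambda>_. 0) (v(j := t))"
    using eventually_line_in[OF U v(1) j(1)]
  proof (rule eventually_mono)
    fix t assume "v(j := t) \<in> U"
    then show "f (v(j := t)) = (\<lambda>_. 0) (v(j := t))"
      using v(2) j(2) by (intro f) auto
  qed
  then have "pd j f v = pd j (\<lambda>_. 0) v" by (rule pd_cong_eventually)
  then show ?thesis by (simp add: pd_def)
qed

lemma foldr_pd_vanishes_on_slice:
  fixes f :: "(nat \<Rightarrow> real) \<Rightarrow> 'b::real_normed_vector"
  assumes U: "openin (Euclidean_space d) U" and "\<forall>j\<in>set js. j < d \<and> j \<notin> I"
    and f: "\<And>v. v \<in> U \<Longrightarrow> (\<forall>i\<in>I. v i = p i) \<Longrightarrow> f v = 0"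
    and "v \<in> U" "\<forall>i\<in>I. v i = p i"
  shows "foldr pd js f v = 0"
  using assms(2,4,5)
proof (induction js arbitrary: v)
  case Nil
  then show ?case using f by simp
next
  case (Cons j js)
  have "pd j (foldr pd js f) v = 0"
    by (rule pd_vanishes_on_slice[OF U _ _ Cons.IH]) (use Cons.prems in auto)
  then show ?case by simp
qed

lemma smooth_on_foldr_pd:
  assumes "smooth_on d U f" "\<forall>j\<in>set js. j < d"
  shows "smooth_on d U (foldr pd js f)"
  using assms(2) by (induction js) (auto intro: assms(1) smooth_on_pd)

lemma mpd_eq_foldr_pd:
  "mpd d \<alpha> f = foldr pd (concat (map (\<lambda>i. replicate (\<alpha> i) i) [0..<d])) f"
proof -
  have "foldr (\<lambda>i. pd i ^^ \<alpha> i) xs f = foldr pd (concat (map (\<lambda>i. replicate (\<alpha> i) i) xs)) f" for xs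
    by (induction xs) (simp_all add: foldr_replicate)
  then show ?thesis by (simp add: mpd_def)
qed

text \<open>
  Near \<open>p\<close>, on the \<open>m\<close>-dimensional slice through \<open>p\<close> in the directions \<open>\<kappa> 0, \<dots>, \<kappa> (m - 1)\<close>, a function that
  vanishes there whenever \<open>v (\<kappa> a) = p (\<kappa> a)\<close> for some \<open>a\<close> is the product of the displacements times its
  mixed derivative at \<open>p\<close>, up to a relative error \<open>\<epsilon>\<close>.
\<close>

lemma iterated_difference_estimate:
  fixes f :: "(nat \<Rightarrow> real) \<Rightarrow> 'b::real_normed_vector"
  assumes f: "smooth_on d U f" and p: "p \<in> U" and "\<epsilon> > 0"
    and inj: "inj_on \<kappa> {..<m}" and \<kappa>: "\<And>a. a < m \<Longrightarrow> \<kappa> a < d"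
    and f0: "\<And>a v. a < m \<Longrightarrow> v \<in> U \<Longrightarrow> (\<forall>i\<in>- \<kappa> ` {..<m}. v i = p i) \<Longrightarrow> v (\<kappa> a) = p (\<kappa> a) \<Longrightarrow> f v = 0"
  obtains r where "r > 0" "ebox d p r \<subseteq> U"
    "\<And>v. v \<in> ebox d p r \<Longrightarrow> (\<forall>i\<in>- \<kappa> ` {..<m}. v i = p i) \<Longrightarrow>
      norm (f v - (\<Prod>a<m. v (\<kappa> a) - p (\<kappa> a)) *\<^sub>R foldr pd (map \<kappa> [0..<m]) f p)
        \<le> \<epsilon> * (\<Prod>a<m. \<bar>v (\<kappa> a) - p (\<kappa> a)\<bar>)"
proof -
  define g where "g j = foldr pd (map \<kappa> [j..<m]) f" for j
  have U: "openin (Euclidean_space d) U" using f by (simp add: smooth_on_def)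
  have gsmooth: "smooth_on d U (g j)" for j
    unfolding g_def by (rule smooth_on_foldr_pd[OF f]) (use \<kappa> in auto)
  have gSuc: "g j = pd (\<kappa> j) (g (Suc j))" if "j < m" for j
    using that by (simp add: g_def upt_conv_Cons)
  have g0: "g (Suc j) v = 0"
    if "j < m" "v \<in> U" "\<forall>i\<in>- \<kappa> ` {..<m}. v i = p i" "v (\<kappa> j) = p (\<kappa> j)" for j v
    unfolding g_def
  proof (rule foldr_pd_vanishes_on_slice[OF U, where I = "insert (\<kappa> j) (- \<kappa> ` {..<m})" and p = p])
    show "\<forall>b\<in>set (map \<kappa> [Suc j..<m]). b < d \<and> b \<notin> insert (\<kappa> j) (- \<kappa> ` {..<m})"
    proof -
      have "\<kappa> b \<noteq> \<kappa> j" if "Suc j \<le> b" "b < m" for b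
        using inj_onD[OF inj, of b j] that by auto
      then show ?thesis using \<kappa> by auto
    qed
  qed (use f0 that in auto)
  define D where "D = g 0 p"
  have "continuous_map (subtopology (Euclidean_space d) U) euclidean (g 0)"
    using gsmooth[of 0] unfolding smooth_on_def by (metis Ck_on_continuous)
  from continuous_map_ebox[OF this U p \<open>\<epsilon> > 0\<close>]
  obtain r where r: "r > 0" "ebox d p r \<subseteq> U" and close: "\<And>w. w \<in> ebox d p r \<Longrightarrow> norm (g 0 w - D) < \<epsilon>"
    unfolding D_def by metis
  \<comment> \<open>Integrate \<open>g 0\<close>, which is close to \<open>D\<close>, one variable at a time: \<open>g (Suc j)\<close> vanishes where the \<open>j\<close>-th
    displacement is 0, and its derivative in that direction is \<open>g j\<close>.\<close>
  have est: "norm (g j v - (\<Prod>a<j. v (\<kappa> a) - p (\<kappa> a)) *\<^sub>R D) \<le> \<epsilon> * (\<Prod>a<j. \<bar>v (\<kappa> a) - p (\<kappa> a)\<bar>)"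
    if "j \<le> m" "v \<in> ebox d p r" "\<forall>i\<in>- \<kappa> ` {..<m}. v i = p i" for j v
    using that
  proof (induction j arbitrary: v)
    case 0
    then show ?case using close[of v] by simp
  next
    case (Suc j)
    have j: "j < m" using Suc.prems by simp
    let ?w = "\<lambda>t. v(\<kappa> j := t)"
    let ?c = "\<Prod>a<j. v (\<kappa> a) - p (\<kappa> a)"
    let ?C = "\<Prod>a<j. \<bar>v (\<kappa> a) - p (\<kappa> a)\<bar>"
    let ?h = "\<lambda>t. g (Suc j) (?w t) - ((t - p (\<kappa> j)) * ?c) *\<^sub>R D"
    have other: "?w t (\<kappa> a) = v (\<kappa> a)" if "a < j" for a t
      using inj_onD[OF inj, of a j] that j by auto
    have box: "?w t \<in> ebox d p r" if "t \<in> closed_segment (p (\<kappa> j)) (v (\<kappa> j))" for t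
    proof -
      have "\<bar>t - p (\<kappa> j)\<bar> \<le> \<bar>v (\<kappa> j) - p (\<kappa> j)\<bar>"
        using that by (auto simp: closed_segment_eq_real_ivl split: if_splits)
      also have "\<dots> < r" using Suc.prems \<kappa>[OF j] by (auto simp: ebox_def)
      finally show ?thesis using Suc.prems \<kappa>[OF j] by (auto simp: ebox_def)
    qed
    have slice: "\<forall>i\<in>- \<kappa> ` {..<m}. ?w t i = p i" for t
      using Suc.prems j by auto
    have "norm (?h (v (\<kappa> j)) - ?h (p (\<kappa> j))) \<le> (\<epsilon> * ?C) * \<bar>v (\<kappa> j) - p (\<kappa> j)\<bar>"
    proof (rule norm_diff_le_segment[where h' = "\<lambda>t. g j (?w t) - ?c *\<^sub>R D"])
      fix t assume t: "t \<in> closed_segment (p (\<kappa> j)) (v (\<kappa> j))"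
      have "has_pd (\<kappa> j) (g (Suc j)) (?w t) (g j (?w t))"
        unfolding gSuc[OF j] using box[OF t] r(2)
        by (intro smooth_on_has_pd[OF gsmooth \<kappa>[OF j]]) blast
      then have "((\<lambda>t. g (Suc j) (?w t)) has_vector_derivative g j (?w t)) (at t)"
        by simp
      then show "(?h has_vector_derivative g j (?w t) - ?c *\<^sub>R D) (at t)"
        by (auto intro!: derivative_eq_intros)
      have "(\<Prod>a<j. ?w t (\<kappa> a) - p (\<kappa> a)) = ?c" "(\<Prod>a<j. \<bar>?w t (\<kappa> a) - p (\<kappa> a)\<bar>) = ?C"
        using other by (simp_all del: fun_upd_apply)
      then show "norm (g j (?w t) - ?c *\<^sub>R D) \<le> \<epsilon> * ?C"
        using Suc.IH[OF less_imp_le[OF j] box[OF t] slice] by (simp del: fun_upd_apply)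
    qed
    moreover have "g (Suc j) (?w (p (\<kappa> j))) = 0"
      using box[of "p (\<kappa> j)"] r(2) slice by (intro g0[OF j]) (auto simp del: fun_upd_apply, simp)
    ultimately show ?case by (simp add: mult.commute mult.left_commute)
  qed
  show ?thesis
    using r est[of m] by (intro that[of r]) (auto simp: g_def D_def)
qed

text \<open>
  The mixed derivative at \<open>p\<close> as a limit of values of \<open>f\<close>. This description does not refer to the order of
  differentiation, so that it replaces the symmetry of mixed partial derivatives below.
\<close>

lemma iterated_difference_limit:
  fixes f :: "(nat \<Rightarrow> real) \<Rightarrow> 'b::real_normed_vector"
  assumes f: "smooth_on d U f" and p: "p \<in> U"
    and inj: "inj_on \<kappa> {..<m}" and \<kappa>: "\<And>a. a < m \<Longrightarrow> \<kappa> a < d"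
    and f0: "\<And>a v. a < m \<Longrightarrow> v \<in> U \<Longrightarrow> (\<forall>i\<in>- \<kappa> ` {..<m}. v i = p i) \<Longrightarrow> v (\<kappa> a) = p (\<kappa> a) \<Longrightarrow> f v = 0"
  shows "((\<lambda>h. (1 / h ^ m) *\<^sub>R f (\<lambda>i. if i \<in> \<kappa> ` {..<m} then p i + h else p i))
           \<longlongrightarrow> foldr pd (map \<kappa> [0..<m]) f p) (at_right 0)"
proof (rule tendstoI)
  fix \<epsilon> :: real assume "\<epsilon> > 0"
  let ?D = "foldr pd (map \<kappa> [0..<m]) f p"
  let ?v = "\<lambda>h i. if i \<in> \<kappa> ` {..<m} then p i + h else p i"
  obtain r where r: "r > 0" and est:
    "\<And>v. v \<in> ebox d p r \<Longrightarrow> (\<forall>i\<in>- \<kappa> ` {..<m}. v i = p i) \<Longrightarrow>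
      norm (f v - (\<Prod>a<m. v (\<kappa> a) - p (\<kappa> a)) *\<^sub>R ?D) \<le> \<epsilon> / 2 * (\<Prod>a<m. \<bar>v (\<kappa> a) - p (\<kappa> a)\<bar>)"
    by (rule iterated_difference_estimate[OF f p _ inj \<kappa> f0, of "\<epsilon> / 2"]) (use \<open>\<epsilon> > 0\<close> in auto)
  have p0: "\<forall>i\<ge>d. p i = 0"
    using openin_Euclidean_space_subset[OF _ p] f by (auto simp: smooth_on_def)
  have "dist ((1 / h ^ m) *\<^sub>R f (?v h)) ?D < \<epsilon>" if h: "0 < h" "h < r" for h
  proof -
    have "i \<notin> \<kappa> ` {..<m}" if "i \<ge> d" for i
      using \<kappa> that by (auto simp: not_le[symmetric])
    then have "?v h \<in> ebox d p r" using h r p0 by (auto simp: ebox_def)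
    then have "norm (f (?v h) - (\<Prod>a<m. ?v h (\<kappa> a) - p (\<kappa> a)) *\<^sub>R ?D)
        \<le> \<epsilon> / 2 * (\<Prod>a<m. \<bar>?v h (\<kappa> a) - p (\<kappa> a)\<bar>)"
      by (rule est) auto
    then have *: "norm (f (?v h) - h ^ m *\<^sub>R ?D) \<le> \<epsilon> / 2 * h ^ m"
      using h by simp
    have "(1 / h ^ m) *\<^sub>R f (?v h) - ?D = (1 / h ^ m) *\<^sub>R (f (?v h) - h ^ m *\<^sub>R ?D)"
      using h by (simp add: scaleR_diff_right)
    then have "dist ((1 / h ^ m) *\<^sub>R f (?v h)) ?D = (1 / h ^ m) * norm (f (?v h) - h ^ m *\<^sub>R ?D)"
      using h unfolding dist_norm by simp
    also have "\<dots> \<le> (1 / h ^ m) * (\<epsilon> / 2 * h ^ m)"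
      using h * by (intro mult_left_mono) auto
    also have "\<dots> < \<epsilon>" using h \<open>\<epsilon> > 0\<close> by simp
    finally show ?thesis .
  qed
  then show "\<forall>\<^sub>F h in at_right 0. dist ((1 / h ^ m) *\<^sub>R f (?v h)) ?D < \<epsilon>"
    unfolding eventually_at_right_field using r by blast
qed

section \<open>Antisymmetric functions of several vectors\<close>

lemma (in comm_monoid_set) nested_blocks:
  fixes n m :: nat
  shows "F g {..<m * n} = F (\<lambda>a. F (\<lambda>i. g (a * n + i)) {..<n}) {..<m}"
  unfolding nat_group[symmetric]
  by (rule cong[OF refl], subst atLeastLessThan_shift_0) (simp add: comp_def lessThan_atLeast0)

lemma block_index_less:
  assumes "a < n" "(i::nat) < d"
  shows "a * d + i < n * d"
proof -
  have "a * d + i < Suc a * d" using assms by simp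
  also have "\<dots> \<le> n * d" using assms by (intro mult_right_mono) auto
  finally show ?thesis .
qed

text \<open>
  The multi-index on \<open>n * n\<close> coordinates, arranged in \<open>n\<close> blocks of length \<open>n\<close>, that has a single 1 in each
  block, namely at position \<open>\<tau> a\<close> in block \<open>a\<close>.
\<close>

definition block_exponent :: "nat \<Rightarrow> (nat \<Rightarrow> nat) \<Rightarrow> nat \<Rightarrow> nat" where
  "block_exponent n \<tau> = (\<lambda>k\<in>{..<n * n}. if k mod n = \<tau> (k div n) then 1 else 0)"

lemma block_exponent_apply:
  assumes "a < n" "i < n"
  shows "block_exponent n \<tau> (a * n + i) = (if i = \<tau> a then 1 else 0)"
  using assms block_index_less[OF assms] by (simp add: block_exponent_def)

lemma mpd_block_exponent:
  assumes "\<And>a. a < n \<Longrightarrow> \<tau> a < n"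
  shows "mpd (n * n) (block_exponent n \<tau>) f = foldr pd (map (\<lambda>a. a * n + \<tau> a) [0..<n]) f"
proof -
  let ?\<alpha> = "block_exponent n \<tau>"
  have "concat (map (\<lambda>i. replicate (?\<alpha> i) i) [0..<m * n]) = map (\<lambda>a. a * n + \<tau> a) [0..<m]" if "m \<le> n" for m
    using that
  proof (induction m)
    case (Suc m)
    then have t: "m < n" "\<tau> m < n" using assms by auto
    have split: "[m * n..<m * n + n] = [m * n..<m * n + \<tau> m] @ (m * n + \<tau> m) # [Suc (m * n + \<tau> m)..<m * n + n]"
      using t(2) upt_add_eq_append[of "m * n" "m * n + \<tau> m" "n - \<tau> m"] by (simp add: upt_conv_Cons)
    have "?\<alpha> k = 0" if "k \<in> {m * n..<m * n + n}" "k \<noteq> m * n + \<tau> m" for k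
      using block_exponent_apply[OF t(1), of "k - m * n" \<tau>] that by auto
    then have empty: "concat (map (\<lambda>i. replicate (?\<alpha> i) i) [m * n..<m * n + \<tau> m]) = []"
        "concat (map (\<lambda>i. replicate (?\<alpha> i) i) [Suc (m * n + \<tau> m)..<m * n + n]) = []"
      using t(2) by (auto simp: concat_eq_Nil_conv)
    have one: "?\<alpha> (m * n + \<tau> m) = 1" using block_exponent_apply[OF t] by simp
    have "concat (map (\<lambda>i. replicate (?\<alpha> i) i) [m * n..<m * n + n]) = [m * n + \<tau> m]"
      unfolding split map_append concat_append list.map concat.simps empty one by simp
    moreover have "[0..<Suc m * n] = [0..<m * n] @ [m * n..<m * n + n]"
      using upt_add_eq_append[of 0 "m * n" n] by (simp add: add.commute)
    ultimately show ?case using Suc by simp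
  qed simp
  from this[OF order_refl] show ?thesis by (simp add: mpd_eq_foldr_pd)
qed

lemma sum_at_least_one_imp_one:
  fixes s :: "nat \<Rightarrow> nat"
  assumes "\<And>a. a < n \<Longrightarrow> s a \<ge> 1" "(\<Sum>a<n. s a) \<le> n" "a < n"
  shows "s a = 1"
proof (rule ccontr)
  assume "s a \<noteq> 1"
  with assms(1,3) have "s a > 1" by force
  then have "(\<Sum>a<n. 1) < (\<Sum>a<n. s a)"
    using assms by (intro sum_strict_mono_ex1) auto
  with assms(2) show False by simp
qed

text \<open>
  A multi-index of order at most \<open>n\<close> on \<open>n\<close> blocks either misses a block or has order exactly 1 in each.
\<close>

lemma exponent_cases:
  assumes \<alpha>: "\<alpha> \<in> {..<n * n} \<rightarrow>\<^sub>E UNIV" and le: "(\<Sum>k<n * n. \<alpha> k) \<le> n"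
  obtains (zero_block) a where "a < n" "\<And>i. i < n \<Longrightarrow> \<alpha> (a * n + i) = 0"
  | (transversal) \<tau> where "\<And>a. a < n \<Longrightarrow> \<tau> a < n" "\<alpha> = block_exponent n \<tau>"
proof (cases "\<exists>a<n. \<forall>i<n. \<alpha> (a * n + i) = 0")
  case True
  then show ?thesis using zero_block by blast
next
  case False
  define s where "s a = (\<Sum>i<n. \<alpha> (a * n + i))" for a
  have "s a \<ge> 1" if a: "a < n" for a
  proof -
    obtain i where i: "i < n" "\<alpha> (a * n + i) \<noteq> 0" using False a by blast
    have "\<alpha> (a * n + i) \<le> s a" unfolding s_def using i by (intro member_le_sum) auto
    then show ?thesis using i by simp
  qed
  moreover have "(\<Sum>a<n. s a) \<le> n" using le by (simp add: s_def sum.nested_blocks)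
  ultimately have s1: "s a = 1" if "a < n" for a
    using sum_at_least_one_imp_one[of n s] that by blast
  have "\<exists>t. t < n \<and> (\<forall>i<n. \<alpha> (a * n + i) = (if i = t then 1 else 0))" if a: "a < n" for a
  proof -
    have "\<exists>t\<in>{..<n}. \<alpha> (a * n + t) = 1 \<and> (\<forall>i\<in>{..<n}. t \<noteq> i \<longrightarrow> \<alpha> (a * n + i) = 0)"
      using s1[OF a] sum_eq_1_iff[of "{..<n}" "\<lambda>i. \<alpha> (a * n + i)"] by (simp add: s_def)
    then show ?thesis by force
  qed
  then obtain \<tau> where \<tau>: "\<And>a. a < n \<Longrightarrow> \<tau> a < n"
      "\<And>a i. a < n \<Longrightarrow> i < n \<Longrightarrow> \<alpha> (a * n + i) = (if i = \<tau> a then 1 else 0)"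
    by metis
  have "\<alpha> = block_exponent n \<tau>"
  proof
    fix k show "\<alpha> k = block_exponent n \<tau> k"
    proof (cases "k < n * n")
      case True
      then have "n > 0" by (cases n) auto
      then have "k div n < n" "k mod n < n" using True by (auto simp: less_mult_imp_div_less)
      then show ?thesis using \<tau>(2)[of "k div n" "k mod n"] True by (simp add: block_exponent_def)
    next
      case False
      then show ?thesis using \<alpha> by (auto simp: block_exponent_def PiE_def extensional_def)
    qed
  qed
  with \<tau>(1) show ?thesis by (rule transversal)
qed

text \<open>
  The point \<open>(q, \<dots>, q)\<close> of \<open>(\<real>\<^sup>n)\<^sup>n\<close>.
\<close>

definition diagonal_point :: "nat \<Rightarrow> (nat \<Rightarrow> real) \<Rightarrow> nat \<Rightarrow> real" where
  "diagonal_point n q = (\<lambda>k. if k < n * n then q (k mod n) else 0)"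

text \<open>
  Block \<open>a\<close> of the result is block \<open>\<sigma> a\<close> of \<open>v\<close>.
\<close>

definition permute_blocks :: "nat \<Rightarrow> (nat \<Rightarrow> nat) \<Rightarrow> (nat \<Rightarrow> real) \<Rightarrow> nat \<Rightarrow> real" where
  "permute_blocks n \<sigma> v = (\<lambda>k. if k < n * n then v (\<sigma> (k div n) * n + k mod n) else 0)"

text \<open>
  A function of \<open>n\<close> vectors in \<open>\<real>\<^sup>n\<close>, smooth near \<open>(q, \<dots>, q)\<close>, that vanishes when an argument is \<open>q\<close> and is
  antisymmetric. The set \<open>U\<close> need not be stable under permutations of the blocks.
\<close>

locale antisymmetric_block_function =
  fixes n :: nat and q :: "nat \<Rightarrow> real" and U :: "(nat \<Rightarrow> real) set"
    and f :: "(nat \<Rightarrow> real) \<Rightarrow> complex"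
  assumes smooth: "smooth_on (n * n) U f"
    and diagonal_in: "diagonal_point n q \<in> U"
    and vanishes: "\<And>a v. a < n \<Longrightarrow> v \<in> U \<Longrightarrow> (\<forall>i<n. v (a * n + i) = q i) \<Longrightarrow> f v = 0"
    and antisymmetric: "\<And>\<sigma> v. \<sigma> permutes {..<n} \<Longrightarrow> v \<in> U \<Longrightarrow>
      f (permute_blocks n \<sigma> v) = of_int (sign \<sigma>) * f v"
begin

abbreviation p :: "nat \<Rightarrow> real" where "p \<equiv> diagonal_point n q"

lemma open_U: "openin (Euclidean_space (n * n)) U"
  using smooth by (simp add: smooth_on_def)

lemma p_block: "a < n \<Longrightarrow> i < n \<Longrightarrow> p (a * n + i) = q i"
  using block_index_less[of a n i n] by (simp add: diagonal_point_def)

text \<open>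
  The mixed derivative at \<open>(q, \<dots>, q)\<close> that differentiates the \<open>a\<close>-th vector once, along its coordinate
  \<open>\<tau> a\<close>.
\<close>

definition slot_derivative :: "(nat \<Rightarrow> nat) \<Rightarrow> complex" where
  "slot_derivative \<tau> = foldr pd (map (\<lambda>a. a * n + \<tau> a) [0..<n]) f p"

text \<open>
  The point whose \<open>a\<close>-th vector is \<open>q\<close> moved by \<open>h\<close> along the coordinate \<open>\<tau> a\<close>.
\<close>

definition displaced :: "(nat \<Rightarrow> nat) \<Rightarrow> real \<Rightarrow> nat \<Rightarrow> real" where
  "displaced \<tau> h = (\<lambda>i. if i \<in> (\<lambda>a. a * n + \<tau> a) ` {..<n} then p i + h else p i)"

lemma displaced_block:
  assumes "\<And>a. a < n \<Longrightarrow> \<tau> a < n" "a < n" "i < n"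
  shows "displaced \<tau> h (a * n + i) = (if i = \<tau> a then q i + h else q i)"
proof -
  have "a * n + i \<in> (\<lambda>a. a * n + \<tau> a) ` {..<n} \<longleftrightarrow> i = \<tau> a"
  proof
    assume "a * n + i \<in> (\<lambda>a. a * n + \<tau> a) ` {..<n}"
    then obtain b where b: "b < n" "a * n + i = b * n + \<tau> b" by auto
    have "(a * n + i) div n = a" "(a * n + i) mod n = i" using assms by auto
    moreover have "(b * n + \<tau> b) div n = b" "(b * n + \<tau> b) mod n = \<tau> b" using assms b by auto
    ultimately show "i = \<tau> a" using b by metis
  qed (use assms in auto)
  then show ?thesis using p_block[OF assms(2,3)]
    by (cases "i = \<tau> a") (simp_all add: displaced_def)
qed

lemma slot_derivative_limit:
  assumes \<tau>: "\<And>a. a < n \<Longrightarrow> \<tau> a < n"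
  shows "((\<lambda>h. (1 / h ^ n) *\<^sub>R f (displaced \<tau> h)) \<longlongrightarrow> slot_derivative \<tau>) (at_right 0)"
  unfolding slot_derivative_def displaced_def
proof (rule iterated_difference_limit[OF smooth diagonal_in])
  let ?\<kappa> = "\<lambda>a. a * n + \<tau> a"
  have div: "?\<kappa> a div n = a" if "a < n" for a using \<tau>[OF that] that by simp
  show "inj_on ?\<kappa> {..<n}" 
  proof (rule inj_onI)
    fix a b assume ab: "a \<in> {..<n}" "b \<in> {..<n}" "?\<kappa> a = ?\<kappa> b"
    have "?\<kappa> a div n = a" "?\<kappa> b div n = b" by (rule div, use ab in simp)+
    then show "a = b" unfolding ab(3) by (rule trans[OF sym])
  qed
  show "?\<kappa> a < n * n" if "a < n" for a using that \<tau> by (intro block_index_less)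
  show "f v = 0" if a: "a < n" and v: "v \<in> U" "\<forall>i\<in>- ?\<kappa> ` {..<n}. v i = p i" "v (?\<kappa> a) = p (?\<kappa> a)" for a v
  proof (rule vanishes[OF a v(1)], intro allI impI)
    fix i assume i: "i < n"
    show "v (a * n + i) = q i"
    proof (cases "i = \<tau> a")
      case True
      then show ?thesis using v(3) p_block[OF a i] by simp
    next
      case False
      have "a * n + i \<notin> ?\<kappa> ` {..<n}"
      proof
        assume "a * n + i \<in> ?\<kappa> ` {..<n}"
        then obtain b where b: "b < n" "a * n + i = ?\<kappa> b" by auto
        have "(a * n + i) div n = a" using i by simp
        then have "b = a" using div[OF b(1)] unfolding b(2) by (rule trans[OF sym, THEN sym])
        with b False show False by simp
      qed
      then show ?thesis using v(2) p_block[OF a i] by auto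
    qed
  qed
qed

lemma eventually_displaced_in: "\<forall>\<^sub>F h in at_right 0. displaced \<tau> h \<in> U" if \<tau>: "\<And>a. a < n \<Longrightarrow> \<tau> a < n"
proof -
  obtain r where r: "r > 0" "ebox (n * n) p r \<subseteq> U"
    using openin_contains_ebox[OF open_U diagonal_in] .
  have "displaced \<tau> h \<in> ebox (n * n) p r" if "0 < h" "h < r" for h
  proof -
    have "i \<notin> (\<lambda>a. a * n + \<tau> a) ` {..<n}" if "i \<ge> n * n" for i
      using block_index_less[OF _ \<tau>] that by (auto simp: not_le[symmetric])
    then show ?thesis using that r by (auto simp: displaced_def ebox_def diagonal_point_def)
  qed
  then show ?thesis unfolding eventually_at_right_field using r by blast
qed

lemma permute_blocks_displaced:
  assumes \<tau>: "\<And>a. a < n \<Longrightarrow> \<tau> a < n" and \<sigma>: "\<sigma> permutes {..<n}"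
  shows "permute_blocks n \<sigma> (displaced \<tau> h) = displaced (\<tau> \<circ> \<sigma>) h"
proof
  fix k
  have \<sigma>lt: "\<sigma> a < n" if "a < n" for a using permutes_in_image[OF \<sigma>] that by auto
  have \<tau>\<sigma>: "(\<tau> \<circ> \<sigma>) a < n" if "a < n" for a using \<tau> \<sigma>lt that by simp
  show "permute_blocks n \<sigma> (displaced \<tau> h) k = displaced (\<tau> \<circ> \<sigma>) h k"
  proof (cases "k < n * n")
    case True
    then have "n > 0" by (cases n) auto
    then have k: "k div n < n" "k mod n < n" using True by (auto simp: less_mult_imp_div_less)
    then show ?thesis
      using displaced_block[of \<tau>, OF \<tau> \<sigma>lt[OF k(1)] k(2), of h]
        displaced_block[of "\<tau> \<circ> \<sigma>", OF \<tau>\<sigma> k, of h] True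
      by (simp add: permute_blocks_def)
  next
    case False
    then have "k \<notin> (\<lambda>a. a * n + (\<tau> \<circ> \<sigma>) a) ` {..<n}"
      using block_index_less[OF _ \<tau>\<sigma>] by auto
    then show ?thesis using False by (simp add: permute_blocks_def displaced_def diagonal_point_def)
  qed
qed

lemma slot_derivative_permute:
  assumes \<tau>: "\<And>a. a < n \<Longrightarrow> \<tau> a < n" and \<sigma>: "\<sigma> permutes {..<n}"
  shows "slot_derivative (\<tau> \<circ> \<sigma>) = of_int (sign \<sigma>) * slot_derivative \<tau>"
proof (rule tendsto_unique)
  have \<tau>\<sigma>: "(\<tau> \<circ> \<sigma>) a < n" if "a < n" for a using \<tau> permutes_in_image[OF \<sigma>] that by auto
  show "((\<lambda>h. (1 / h ^ n) *\<^sub>R f (displaced (\<tau> \<circ> \<sigma>) h)) \<longlongrightarrow> slot_derivative (\<tau> \<circ> \<sigma>)) (at_right 0)"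
    by (rule slot_derivative_limit[OF \<tau>\<sigma>])
  have "((\<lambda>h. of_int (sign \<sigma>) * ((1 / h ^ n) *\<^sub>R f (displaced \<tau> h)))
      \<longlongrightarrow> of_int (sign \<sigma>) * slot_derivative \<tau>) (at_right 0)"
    by (intro tendsto_mult_left slot_derivative_limit \<tau>)
  moreover have "\<forall>\<^sub>F h in at_right 0. of_int (sign \<sigma>) * ((1 / h ^ n) *\<^sub>R f (displaced \<tau> h)) =
      (1 / h ^ n) *\<^sub>R f (displaced (\<tau> \<circ> \<sigma>) h)"
    using eventually_displaced_in[OF \<tau>]
  proof (rule eventually_mono)
    fix h assume "displaced \<tau> h \<in> U"
    moreover have "permute_blocks n \<sigma> (displaced \<tau> h) = displaced (\<tau> \<circ> \<sigma>) h"
      by (rule permute_blocks_displaced) (use \<tau> \<sigma> in auto)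
    ultimately have "f (displaced (\<tau> \<circ> \<sigma>) h) = of_int (sign \<sigma>) * f (displaced \<tau> h)"
      using antisymmetric[OF \<sigma>] by metis
    then
    show "of_int (sign \<sigma>) * ((1 / h ^ n) *\<^sub>R f (displaced \<tau> h)) = (1 / h ^ n) *\<^sub>R f (displaced (\<tau> \<circ> \<sigma>) h)"
      by simp
  qed
  ultimately show "((\<lambda>h. (1 / h ^ n) *\<^sub>R f (displaced (\<tau> \<circ> \<sigma>) h))
      \<longlongrightarrow> of_int (sign \<sigma>) * slot_derivative \<tau>) (at_right 0)"
    by (rule Lim_transform_eventually)
qed simp

lemma slot_derivative_not_inj:
  assumes \<tau>: "\<And>a. a < n \<Longrightarrow> \<tau> a < n" and "\<not> inj_on \<tau> {..<n}"
  shows "slot_derivative \<tau> = 0"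
proof -
  obtain a b where ab: "a < n" "b < n" "a \<noteq> b" "\<tau> a = \<tau> b"
    using assms(2) by (auto simp: inj_on_def)
  have \<sigma>: "Transposition.transpose a b permutes {..<n}" using ab by (intro permutes_swap_id) auto
  have "\<tau> \<circ> Transposition.transpose a b = \<tau>" using ab by (auto simp: fun_eq_iff Transposition.transpose_def)
  then have "slot_derivative \<tau> = - slot_derivative \<tau>"
    using slot_derivative_permute[of \<tau>, OF \<tau> \<sigma>] ab by (simp add: sign_swap_id)
  then show ?thesis by simp
qed

text \<open>
  A derivative that does not touch the \<open>a\<close>-th vector stays within the slice where that vector is \<open>q\<close>, on
  which the function is 0.
\<close>

lemma mpd_zero_block:
  assumes a: "a < n" and zero: "\<And>i. i < n \<Longrightarrow> \<alpha> (a * n + i) = 0"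
  shows "mpd (n * n) \<alpha> f p = 0"
  unfolding mpd_eq_foldr_pd
proof (rule foldr_pd_vanishes_on_slice[OF open_U, where I = "(\<lambda>i. a * n + i) ` {..<n}" and p = p])
  show "\<forall>j\<in>set (concat (map (\<lambda>i. replicate (\<alpha> i) i) [0..<n * n])).
      j < n * n \<and> j \<notin> (\<lambda>i. a * n + i) ` {..<n}"
    using zero by (auto simp: in_set_replicate)
  show "f v = 0" if "v \<in> U" "\<forall>i\<in>(\<lambda>i. a * n + i) ` {..<n}. v i = p i" for v
    using vanishes[OF a that(1)] that(2) p_block[OF a] by auto
qed (use diagonal_in in auto)

text \<open>
  Only the multi-indices \<open>block_exponent n \<sigma>\<close> with \<open>\<sigma>\<close> a permutation contribute. Their coefficients are
  \<open>sign \<sigma>\<close> times a common constant, so that the sum is the Leibniz expansion of a determinant.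
\<close>

theorem taylor_polynomial:
  "is_taylor_polynomial n (n * n) f p (\<lambda>y. slot_derivative (\<lambda>a. a) * of_real (Vol_Delta n q y))"
  unfolding is_taylor_polynomial_def
proof (intro conjI ballI)
  show "\<exists>U. p \<in> U \<and> smooth_on (n * n) U f" using smooth diagonal_in by blast
  fix y :: "nat \<Rightarrow> real"
  let ?A = "{\<alpha> \<in> {..<n * n} \<rightarrow>\<^sub>E (UNIV :: nat set). (\<Sum>i<n * n. \<alpha> i) \<le> n}"
  let ?P = "{\<sigma>. \<sigma> permutes {..<n}}"
  let ?term = "\<lambda>\<alpha>. mpd (n * n) \<alpha> f p / (\<Prod>i<n * n. fact (\<alpha> i)) * of_real (\<Prod>i<n * n. (y i - p i) ^ \<alpha> i)"
  have perm_lt: "\<sigma> a < n" if "\<sigma> permutes {..<n}" "a < n" for \<sigma> a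
    using permutes_in_image[OF that(1)] that(2) by auto
  have "?A \<subseteq> {..<n * n} \<rightarrow>\<^sub>E {..n}"
  proof
    fix \<alpha> assume \<alpha>: "\<alpha> \<in> ?A"
    have "\<alpha> i \<le> n" if "i < n * n" for i
      using member_le_sum[of i "{..<n * n}" \<alpha>] \<alpha> that by auto
    then show "\<alpha> \<in> {..<n * n} \<rightarrow>\<^sub>E {..n}" using \<alpha> by (auto simp: PiE_iff)
  qed
  then have fin: "finite ?A" by (rule finite_subset) (intro finite_PiE; simp)
  have sub: "block_exponent n ` ?P \<subseteq> ?A"
  proof (rule image_subsetI)
    fix \<sigma> assume "\<sigma> \<in> ?P"
    then have \<sigma>: "\<sigma> permutes {..<n}" by simp
    have "(\<Sum>k<n * n. block_exponent n \<sigma> k) = (\<Sum>a<n. \<Sum>i<n. if i = \<sigma> a then 1 else 0)"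
      unfolding sum.nested_blocks by (intro sum.cong refl) (simp add: block_exponent_apply)
    also have "\<dots> = n" using perm_lt[OF \<sigma>] by (simp add: sum.delta)
    finally show "block_exponent n \<sigma> \<in> ?A"
      by (simp add: PiE_iff) (simp add: block_exponent_def)
  qed
  have zero: "?term \<alpha> = 0" if "\<alpha> \<in> ?A - block_exponent n ` ?P" for \<alpha>
  proof -
    from that have "\<alpha> \<in> {..<n * n} \<rightarrow>\<^sub>E UNIV" "(\<Sum>k<n * n. \<alpha> k) \<le> n" by auto
    then have "mpd (n * n) \<alpha> f p = 0"
    proof (cases rule: exponent_cases)
      case (zero_block a)
      then show ?thesis by (rule mpd_zero_block)
    next
      case (transversal \<tau>)
      have "\<not> inj_on \<tau> {..<n}"
      proof
        assume inj: "inj_on \<tau> {..<n}"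
        \<comment> \<open>A permutation is the identity from \<open>n\<close> on, whereas \<open>\<tau>\<close> is arbitrary there.\<close>
        define \<sigma> where "\<sigma> a = (if a < n then \<tau> a else a)" for a
        have "inj_on \<sigma> {..<n}" using inj by (simp add: \<sigma>_def inj_on_def)
        moreover have "\<sigma> ` {..<n} \<subseteq> {..<n}" using transversal(1) by (auto simp: \<sigma>_def)
        ultimately have "bij_betw \<sigma> {..<n} {..<n}"
          by (simp add: bij_betw_def endo_inj_surj)
        then have "\<sigma> permutes {..<n}" by (rule bij_imp_permutes) (simp add: \<sigma>_def)
        moreover have "\<alpha> = block_exponent n \<sigma>"
          unfolding transversal(2) block_exponent_def \<sigma>_def
          by (auto simp: fun_eq_iff restrict_def less_mult_imp_div_less)
        ultimately show False using that by auto
      qed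
      then show ?thesis
        using slot_derivative_not_inj[OF transversal(1)]
        by (simp add: transversal(2) mpd_block_exponent transversal(1) slot_derivative_def)
    qed
    then show ?thesis by simp
  qed
  have inj: "inj_on (block_exponent n) ?P"
  proof (rule inj_onI)
    fix \<sigma> \<sigma>' assume *: "\<sigma> \<in> ?P" "\<sigma>' \<in> ?P" "block_exponent n \<sigma> = block_exponent n \<sigma>'"
    show "\<sigma> = \<sigma>'"
    proof
      fix a show "\<sigma> a = \<sigma>' a"
      proof (cases "a < n")
        case True
        have lt: "\<sigma> a < n" using * True perm_lt by simp
        show ?thesis
        proof (rule ccontr)
          assume "\<sigma> a \<noteq> \<sigma>' a"
          then have "block_exponent n \<sigma>' (a * n + \<sigma> a) = 0"
            by (simp add: block_exponent_apply[OF True lt])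
          moreover have "block_exponent n \<sigma> (a * n + \<sigma> a) = 1"
            by (simp add: block_exponent_apply[OF True lt])
          ultimately show False unfolding *(3) by simp
        qed
      next
        case False
        then show ?thesis using * by (simp add: permutes_not_in)
      qed
    qed
  qed
  have term_eq: "?term (block_exponent n \<sigma>) =
      slot_derivative (\<lambda>a. a) * of_real (of_int (sign \<sigma>) * (\<Prod>a<n. y (a * n + \<sigma> a) - q (\<sigma> a)))"
    if "\<sigma> \<in> ?P" for \<sigma>
  proof -
    from that have \<sigma>: "\<sigma> permutes {..<n}" by simp
    have "mpd (n * n) (block_exponent n \<sigma>) f p = slot_derivative ((\<lambda>a. a) \<circ> \<sigma>)"
      using perm_lt[OF \<sigma>] by (simp add: mpd_block_exponent slot_derivative_def)
    also have "\<dots> = of_int (sign \<sigma>) * slot_derivative (\<lambda>a. a)"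
      by (rule slot_derivative_permute) (use \<sigma> in auto)
    finally have 1: "mpd (n * n) (block_exponent n \<sigma>) f p = of_int (sign \<sigma>) * slot_derivative (\<lambda>a. a)" .
    have 2: "(\<Prod>k<n * n. fact (block_exponent n \<sigma> k)) = (1 :: complex)"
      by (rule prod.neutral) (simp add: block_exponent_def)
    have "(\<Prod>k<n * n. (y k - p k) ^ block_exponent n \<sigma> k) =
        (\<Prod>a<n. \<Prod>i<n. if i = \<sigma> a then y (a * n + i) - q i else 1)"
      unfolding prod.nested_blocks by (intro prod.cong refl) (simp add: block_exponent_apply p_block)
    also have "\<dots> = (\<Prod>a<n. y (a * n + \<sigma> a) - q (\<sigma> a))"
      using perm_lt[OF \<sigma>] by (intro prod.cong refl) (simp add: prod.delta)
    finally show ?thesis unfolding 1 2 by (simp add: mult.commute mult.left_commute)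
  qed
  have "(\<Sum>\<alpha>\<in>?A. ?term \<alpha>) = (\<Sum>\<alpha>\<in>block_exponent n ` ?P. ?term \<alpha>)"
    using sub zero by (intro sum.mono_neutral_right[OF fin]) auto
  also have "\<dots> = (\<Sum>\<sigma>\<in>?P. ?term (block_exponent n \<sigma>))"
    by (simp add: sum.reindex[OF inj])
  also have "\<dots> = slot_derivative (\<lambda>a. a) * of_real (\<Sum>\<sigma>\<in>?P. of_int (sign \<sigma>) * (\<Prod>a<n. y (a * n + \<sigma> a) - q (\<sigma> a)))"
    unfolding of_real_sum sum_distrib_left by (intro sum.cong refl term_eq)
  also have "(\<Sum>\<sigma>\<in>?P. of_int (sign \<sigma>) * (\<Prod>a<n. y (a * n + \<sigma> a) - q (\<sigma> a))) = Vol_Delta n q y"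
    unfolding Vol_Delta_def Determinant.det_def
    using perm_lt by (simp add: lessThan_atLeast0)
  finally show "slot_derivative (\<lambda>a. a) * of_real (Vol_Delta n q y) = (\<Sum>\<alpha>\<in>?A. ?term \<alpha>)" ..
qed

end

section \<open>Smooth functions in charts\<close>

lemma is_chartD:
  assumes "is_chart T d c"
  shows "openin T (fst c)" "openin (Euclidean_space d) (snd c ` fst c)"
    "homeomorphic_map (subtopology T (fst c)) (subtopology (Euclidean_space d) (snd c ` fst c)) (snd c)"
    "inj_on (snd c) (fst c)"
    "\<And>g i. g \<in> fst c \<Longrightarrow> i \<ge> d \<Longrightarrow> snd c g i = 0"
proof -
  show 1: "openin T (fst c)" "openin (Euclidean_space d) (snd c ` fst c)"
    "homeomorphic_map (subtopology T (fst c)) (subtopology (Euclidean_space d) (snd c ` fst c)) (snd c)"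
    using assms by (auto simp: is_chart_def split: prod.splits)
  have "topspace (subtopology T (fst c)) = fst c"
    using openin_subset[OF 1(1)] by auto
  then show "inj_on (snd c) (fst c)" using homeomorphic_imp_injective_map[OF 1(3)] by simp
  show "snd c g i = 0" if "g \<in> fst c" "i \<ge> d" for g i
    using openin_Euclidean_space_subset[OF 1(2), of "snd c g"] that by auto
qed

lemma is_chart_inverse_continuous:
  assumes "is_chart T d c"
  shows "continuous_map (subtopology (Euclidean_space d) (snd c ` fst c)) T (inv_into (fst c) (snd c))"
proof -
  note c = is_chartD[OF assms]
  obtain g where g: "homeomorphic_maps (subtopology T (fst c))
      (subtopology (Euclidean_space d) (snd c ` fst c)) (snd c) g"
    using c(3) homeomorphic_map_maps by blast
  have top: "topspace (subtopology T (fst c)) = fst c"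
      "topspace (subtopology (Euclidean_space d) (snd c ` fst c)) = snd c ` fst c"
    using openin_subset[OF c(1)] openin_subset[OF c(2)] by auto
  have "continuous_map (subtopology (Euclidean_space d) (snd c ` fst c)) T g"
    using g continuous_map_into_fulltopology by (auto simp: homeomorphic_maps_def)
  moreover have "g w = inv_into (fst c) (snd c) w" if "w \<in> snd c ` fst c" for w
  proof -
    from that obtain h where h: "h \<in> fst c" "w = snd c h" by auto
    then have "g w = h" using g top by (simp add: homeomorphic_maps_def)
    then show ?thesis using h c(4) by simp
  qed
  ultimately show ?thesis
    by (rule continuous_map_eq) (simp add: top)
qed

text \<open>
  If \<open>f\<close> is smooth in the chart \<open>s\<close> and the map \<open>\<gamma>\<close> from \<open>U \<subseteq> \<real>\<^sup>d\<close> is smooth in the coordinates of \<open>s\<close>, then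
  \<open>f \<circ> \<gamma>\<close> is smooth. The set \<open>A\<close> may be smaller than the domain of \<open>s\<close>, for instance its overlap with
  another chart.
\<close>

lemma smooth_on_in_chart_compose:
  assumes f: "smooth_on e (snd s ` A) (in_chart s f)"
    and s: "inj_on (snd s) (fst s)" "A \<subseteq> fst s"
    and U: "openin (Euclidean_space d) U" and \<gamma>: "\<And>v. v \<in> U \<Longrightarrow> \<gamma> v \<in> A"
    and sm: "\<And>j. j < e \<Longrightarrow> smooth_on d U (\<lambda>v. snd s (\<gamma> v) j)"
  shows "smooth_on d U (\<lambda>v. f (\<gamma> v))"
proof (rule smooth_on_cong)
  show "smooth_on d U (\<lambda>v. in_chart s f (snd s (\<gamma> v)))"
    by (rule smooth_on_compose[OF U _ sm f]) (use \<gamma> in auto)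
  show "in_chart s f (snd s (\<gamma> v)) = f (\<gamma> v)" if "v \<in> U" for v
    using \<gamma>[OF that] s by (auto simp: in_chart_def inv_into_f_f)
qed

lemma smooth_on_coordinate:
  "openin (Euclidean_space d) U \<Longrightarrow> smooth_on d U (\<lambda>v. v j)"
  by (simp add: smooth_on_def Ck_on_coordinate)

lemma smooth_on_zero:
  "openin (Euclidean_space d) U \<Longrightarrow> (\<And>v. v \<in> U \<Longrightarrow> f v = 0) \<Longrightarrow> smooth_on d U f"
  by (rule smooth_on_cong[of d U "\<lambda>_. 0"]) (simp_all add: smooth_on_def Ck_on_const)

lemma power_chart_inj:
  assumes inj: "inj_on (snd c) (fst c)" and 0: "\<And>g i. g \<in> fst c \<Longrightarrow> i \<ge> d \<Longrightarrow> snd c g i = 0"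
  shows "inj_on (snd (power_chart n d (\<lambda>_. c))) (fst (power_chart n d (\<lambda>_. c)))"
proof (rule inj_onI)
  fix g h assume gh: "g \<in> fst (power_chart n d (\<lambda>_. c))" "h \<in> fst (power_chart n d (\<lambda>_. c))"
    and eq: "snd (power_chart n d (\<lambda>_. c)) g = snd (power_chart n d (\<lambda>_. c)) h"
  have mem: "g \<in> {..<n} \<rightarrow>\<^sub>E fst c" "h \<in> {..<n} \<rightarrow>\<^sub>E fst c"
    using gh by (auto simp: power_chart_def)
  show "g = h"
  proof (rule PiE_ext[OF mem])
    fix a assume a: "a \<in> {..<n}"
    have in_c: "g a \<in> fst c" "h a \<in> fst c" using mem a by auto
    have "snd c (g a) i = snd c (h a) i" for i
    proof (cases "i < d")
      case True
      then show ?thesis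
        using fun_cong[OF eq, of "a * d + i"] block_index_less[of a n i d] a
        by (simp add: power_chart_def)
    next
      case False
      then show ?thesis using 0 in_c by simp
    qed
    then have "snd c (g a) = snd c (h a)" by auto
    then show "g a = h a" using inj_onD[OF inj] in_c by blast
  qed
qed

section \<open>Cochains near a tuple of identity arrows\<close>

text \<open>
  A normalized antisymmetric cochain and a chart \<open>c\<close> of the source fiber at \<open>x\<close> around the identity arrow.
\<close>

locale cochain_at_object =
  fixes G :: "('g, 'x) groupoid" and n :: nat and \<Omega> :: "(nat \<Rightarrow> 'g) \<Rightarrow> complex"
    and x :: 'x and c :: "'g chart"
  assumes lie: "lie_groupoid G"
    and fibers: "src_fibers_dim n G"
    and cochain: "cochain n G \<Omega>"
    and normalized: "normalized n G \<Omega>"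
    and antisym: "antisymmetric_cochain n G \<Omega>"
    and x: "x \<in> Obj G"
    and c_atlas: "c \<in> maximal_atlas (src_fiber_mfd n G x)"
    and ident_in: "ident G x \<in> fst c"
begin

abbreviation e :: 'g where "e \<equiv> ident G x"
abbreviation S :: "'g set" where "S \<equiv> src_fiber G x"
abbreviation N :: nat where "N \<equiv> mdim (arrows G)"
abbreviation q :: "nat \<Rightarrow> real" where "q \<equiv> snd c e"
abbreviation \<psi> :: "(nat \<Rightarrow> real) \<Rightarrow> 'g" where "\<psi> \<equiv> inv_into (fst c) (snd c)"

text \<open>
  The \<open>a\<close>-th vector of \<open>v\<close>, padded by zeros to an element of \<open>\<real>\<^sup>n\<close>.
\<close>

definition block :: "nat \<Rightarrow> (nat \<Rightarrow> real) \<Rightarrow> nat \<Rightarrow> real" where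
  "block a v = (\<lambda>i. if i < n then v (a * n + i) else 0)"

text \<open>
  The tuple of arrows with coordinates \<open>v\<close>, the inverse of the product chart.
\<close>

definition tuple :: "(nat \<Rightarrow> real) \<Rightarrow> nat \<Rightarrow> 'g" where
  "tuple v = (\<lambda>a\<in>{..<n}. \<psi> (block a v))"

text \<open>
  The image of the product chart.
\<close>

definition chart_range :: "(nat \<Rightarrow> real) set" where
  "chart_range = {v \<in> topspace (Euclidean_space (n * n)). \<forall>a<n. block a v \<in> snd c ` fst c}"

abbreviation F :: "(nat \<Rightarrow> real) \<Rightarrow> complex" where
  "F \<equiv> in_chart (power_chart n n (\<lambda>_. c)) \<Omega>"

lemma c_chart: "is_chart (subtopology (mtop (arrows G)) S) n c"
  using c_atlas by (simp add: maximal_atlas_def src_fiber_mfd_def submfd_def)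

lemmas c_inj = is_chartD(4)[OF c_chart]
lemmas c_zero = is_chartD(5)[OF c_chart]

lemma fst_c: "fst c \<subseteq> S" "S \<subseteq> Arr G"
  using openin_subset[OF is_chartD(1)[OF c_chart]] by (auto simp: src_fiber_def)

lemma ident_arrow: "e \<in> Arr G" "src G e = x"
  using lie x by (auto simp: lie_groupoid_def is_groupoid_def)

lemma \<psi>: "w \<in> snd c ` fst c \<Longrightarrow> \<psi> w \<in> fst c" "w \<in> snd c ` fst c \<Longrightarrow> snd c (\<psi> w) = w"
  by (auto simp: inv_into_into f_inv_into_f)

lemma \<psi>_q: "\<psi> q = e"
  using c_inj ident_in by simp

lemma tuple_in_fiber:
  assumes "v \<in> chart_range"
  shows "tuple v \<in> {..<n} \<rightarrow>\<^sub>E fst c"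
  using assms \<psi>(1) by (auto simp: tuple_def chart_range_def)

lemma tuple_in_nerve:
  assumes "v \<in> chart_range"
  shows "tuple v \<in> nerve n G"
proof -
  have "tuple v a \<in> S" if "a < n" for a
    using tuple_in_fiber[OF assms] fst_c that by (auto simp: PiE_iff)
  then show ?thesis
    using tuple_in_fiber[OF assms] by (simp add: nerve_def src_fiber_def PiE_iff)
qed

lemma in_chart_eq:
  assumes "v \<in> chart_range"
  shows "F v = \<Omega> (tuple v)"
proof -
  have "snd (power_chart n n (\<lambda>_. c)) (tuple v) = v"
  proof
    fix k
    show "snd (power_chart n n (\<lambda>_. c)) (tuple v) k = v k"
    proof (cases "k < n * n")
      case True
      then have "n > 0" by (cases n) auto
      then have k: "k div n < n" "k mod n < n" using True by (auto simp: less_mult_imp_div_less)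
      then have "snd c (\<psi> (block (k div n) v)) = block (k div n) v"
        using assms \<psi>(2) by (simp add: chart_range_def)
      then show ?thesis using True k by (simp add: power_chart_def tuple_def block_def)
    next
      case False
      then show ?thesis using assms by (simp add: power_chart_def chart_range_def topspace_Euclidean_space)
    qed
  qed
  moreover have "tuple v \<in> fst (power_chart n n (\<lambda>_. c))"
    using tuple_in_fiber[OF assms] by (simp add: power_chart_def)
  ultimately have "inv_into (fst (power_chart n n (\<lambda>_. c))) (snd (power_chart n n (\<lambda>_. c))) v = tuple v"
    using power_chart_inj[OF c_inj c_zero] by (intro inv_into_f_eq)
  then show ?thesis by (simp add: in_chart_def)
qed

lemma continuous_map_block: "continuous_map (Euclidean_space (n * n)) (Euclidean_space n) (block a)"
proof -
  have "continuous_map (Euclidean_space (n * n)) euclideanreal (\<lambda>v. block a v i)" for i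
    unfolding Euclidean_space_def block_def
    by (cases "i < n") (auto intro: continuous_map_from_subtopology continuous_map_product_projection)
  then have "continuous_map (Euclidean_space (n * n)) (powertop_real UNIV) (block a)"
    by (simp add: continuous_map_componentwise_UNIV)
  then show ?thesis
    by (subst (2) Euclidean_space_def) (auto simp: continuous_map_in_subtopology block_def)
qed

lemma open_chart_range: "openin (Euclidean_space (n * n)) chart_range"
proof -
  let ?E = "Euclidean_space (n * n)"
  have "openin ?E ((\<Inter>a\<in>{..<n}. {v \<in> topspace ?E. block a v \<in> snd c ` fst c}) \<inter> topspace ?E)"
    by (intro openin_INT finite_lessThan openin_continuous_map_preimage[OF continuous_map_block]
        is_chartD(2)[OF c_chart])
  moreover have "(\<Inter>a\<in>{..<n}. {v \<in> topspace ?E. block a v \<in> snd c ` fst c}) \<inter> topspace ?E = chart_range"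
    by (auto simp: chart_range_def)
  ultimately show ?thesis by simp
qed

lemma continuous_map_tuple:
  "continuous_map (subtopology (Euclidean_space (n * n)) chart_range)
     (product_topology (\<lambda>_. mtop (arrows G)) {..<n}) tuple"
proof -
  have "continuous_map (subtopology (Euclidean_space (n * n)) chart_range) (mtop (arrows G)) (\<lambda>v. tuple v a)"
    if a: "a < n" for a
  proof -
    have "continuous_map (subtopology (Euclidean_space (n * n)) chart_range)
        (subtopology (Euclidean_space n) (snd c ` fst c)) (block a)"
      using continuous_map_block a
      by (auto simp: continuous_map_in_subtopology chart_range_def intro: continuous_map_from_subtopology)
    from continuous_map_compose[OF this is_chart_inverse_continuous[OF c_chart]]
    have "continuous_map (subtopology (Euclidean_space (n * n)) chart_range) (mtop (arrows G)) (\<psi> \<circ> block a)"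
      by (rule continuous_map_into_fulltopology)
    then show ?thesis using a by (simp add: tuple_def comp_def)
  qed
  moreover have "tuple ` topspace (subtopology (Euclidean_space (n * n)) chart_range) \<subseteq> extensional {..<n}"
    by (auto simp: tuple_def)
  ultimately show ?thesis
    by (simp add: continuous_map_componentwise)
qed

lemma block_diagonal: "a < n \<Longrightarrow> block a (diagonal_point n q) = q"
  using c_zero[OF ident_in] block_index_less[of a n _ n] by (auto simp: block_def diagonal_point_def fun_eq_iff)

lemma diagonal_in_chart_range: "diagonal_point n q \<in> chart_range"
  using block_diagonal ident_in
  by (auto simp: chart_range_def topspace_Euclidean_space) (simp add: diagonal_point_def)

lemma tuple_diagonal: "tuple (diagonal_point n q) = ident_tuple n G x"
  by (auto simp: tuple_def ident_tuple_def block_diagonal \<psi>_q fun_eq_iff restrict_def)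

text \<open>
  Smoothness of \<open>\<Omega>\<close> is given in a slice chart \<open>C\<close> of the ambient power of the arrow manifold, whereas \<open>c\<close> is
  a chart of the source fiber. The coordinates of \<open>tuple v\<close> are therefore shown to depend smoothly on \<open>v\<close>
  successively in the chart \<open>c\<close>, a slice chart \<open>s\<close> of the fiber, a chart \<open>b\<close> of the arrow
  manifold, its power, and \<open>C\<close>; each step is a change of charts.
\<close>

lemma smooth_near_diagonal:
  obtains U where "diagonal_point n q \<in> U" "U \<subseteq> chart_range" "smooth_on (n * n) U F"
proof -
  let ?E = "Euclidean_space (n * n)"
  have mfd: "smooth_mfd (arrows G)" using lie by (simp add: lie_groupoid_def)
  have "e \<in> S" using ident_in fst_c by auto
  then obtain s where s: "s \<in> slice_charts n (arrows G) S" "e \<in> fst s"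
    using fibers x unfolding src_fibers_dim_def embedded_submfd_def by blast
  obtain b where b: "b \<in> atlas (arrows G)" "e \<in> fst b"
    using mfd ident_arrow(1) unfolding smooth_mfd_def by blast
  have b_max: "b \<in> maximal_atlas (arrows G)" using mfd b by (auto simp: smooth_mfd_def)
  have s_max: "s \<in> maximal_atlas (arrows G)" using s by (simp add: slice_charts_def)
  let ?M = "power_mfd n (arrows G)"
  have "nerve n G \<subseteq> {..<n} \<rightarrow>\<^sub>E Arr G" unfolding nerve_def by blast
  then have "topspace (mtop (nerve_mfd n G)) = nerve n G"
    by (auto simp: nerve_mfd_def submfd_def power_mfd_def)
  moreover have "ident_tuple n G x \<in> nerve n G"
    using tuple_in_nerve[OF diagonal_in_chart_range] by (simp add: tuple_diagonal)
  ultimately obtain D where D: "D \<in> atlas (nerve_mfd n G)" "ident_tuple n G x \<in> fst D"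
      "smooth_on (mdim (nerve_mfd n G)) (snd D ` fst D) (in_chart D \<Omega>)"
    using cochain unfolding cochain_def smooth_fun_def by blast
  define k where "k = mdim (nerve_mfd n G)"
  obtain C where C: "C \<in> slice_charts k ?M (nerve n G)" and D_eq: "D = (fst C \<inter> nerve n G, snd C)"
    using D(1) by (auto simp: k_def nerve_mfd_def submfd_def)
  have C_in: "ident_tuple n G x \<in> fst C" using D(2) D_eq by simp
  have \<Omega>_smooth: "smooth_on k (snd C ` (fst C \<inter> nerve n G)) (in_chart (fst C \<inter> nerve n G, snd C) \<Omega>)"
    using D(3) by (simp add: D_eq k_def)
  have C_max: "C \<in> maximal_atlas ?M" using C by (simp add: slice_charts_def)
  let ?B = "power_chart n N (\<lambda>_. b)"
  have b_chart: "is_chart (mtop (arrows G)) N b" and s_chart: "is_chart (mtop (arrows G)) N s"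
    using b_max s_max by (auto simp: maximal_atlas_def)
  have C_chart: "is_chart (product_topology (\<lambda>_. mtop (arrows G)) {..<n}) (n * N) C"
    using C_max by (simp add: maximal_atlas_def power_mfd_def)
  have "?B \<in> atlas ?M" using b(1) by (auto simp: power_mfd_def)
  then have "compatible (mdim ?M) C ?B" using C_max unfolding maximal_atlas_def by blast
  moreover have "mdim ?M = n * N" by (simp add: power_mfd_def)
  ultimately have B_C: "smooth_on (n * N) (snd ?B ` (fst ?B \<inter> fst C)) (in_chart ?B (\<lambda>p. snd C p i))"
    if "i < n * N" for i
    using that by (simp add: compatible_def transition_smooth_def)
  have s_b: "smooth_on N (snd s ` (fst s \<inter> fst b)) (in_chart s (\<lambda>p. snd b p i))" if "i < N" for i
    using s_max b(1) that by (auto simp: maximal_atlas_def compatible_def transition_smooth_def)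
  have "(fst s \<inter> S, snd s) \<in> atlas (src_fiber_mfd n G x)"
    using s(1) unfolding src_fiber_mfd_def submfd_def mfd.simps by blast
  then have "compatible (mdim (src_fiber_mfd n G x)) c (fst s \<inter> S, snd s)"
    using c_atlas unfolding maximal_atlas_def by blast
  moreover have "mdim (src_fiber_mfd n G x) = n" by (simp add: src_fiber_mfd_def submfd_def)
  ultimately have c_s: "smooth_on n (snd c ` (fst c \<inter> (fst s \<inter> S))) (in_chart c (\<lambda>p. snd s p i))" if "i < n" for i
    using that by (simp add: compatible_def transition_smooth_def)
  define W where "W = fst C \<inter> ({..<n} \<rightarrow>\<^sub>E fst s \<inter> fst b)"
  have openW: "openin (product_topology (\<lambda>_. mtop (arrows G)) {..<n}) W"
    unfolding W_def using is_chartD(1)[OF b_chart] is_chartD(1)[OF s_chart] is_chartD(1)[OF C_chart]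
    by (intro openin_Int) (auto simp: openin_PiE)
  define U where "U = {v \<in> chart_range. tuple v \<in> W}"
  have top: "topspace (subtopology ?E chart_range) = chart_range"
    using openin_subset[OF open_chart_range] by auto
  have "openin (subtopology ?E chart_range) U"
    using openin_continuous_map_preimage[OF continuous_map_tuple openW] unfolding top U_def .
  then have openU: "openin ?E U" using openin_trans_full open_chart_range by blast
  have diag: "diagonal_point n q \<in> U"
    using diagonal_in_chart_range C_in s(2) b(2)
    by (simp add: U_def W_def tuple_diagonal ident_tuple_def PiE_iff)
  have U: "v \<in> chart_range" "tuple v \<in> fst C" "\<And>a. a < n \<Longrightarrow> tuple v a \<in> fst c \<inter> S \<inter> fst s \<inter> fst b"
    if "v \<in> U" for v
    using that tuple_in_fiber[of v] fst_c(1) by (auto simp: U_def W_def PiE_iff)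
  have in_c: "smooth_on (n * n) U (\<lambda>v. snd c (tuple v a) j)" if "a < n" "j < n" for a j
  proof (rule smooth_on_cong[OF smooth_on_coordinate[OF openU, of "a * n + j"]])
    fix v assume "v \<in> U"
    then have "snd c (tuple v a) = block a v"
      using U(1) \<psi>(2) that by (auto simp: tuple_def chart_range_def)
    then show "v (a * n + j) = snd c (tuple v a) j" using that by (simp add: block_def)
  qed
  have in_s: "smooth_on (n * n) U (\<lambda>v. snd s (tuple v a) i)" if a: "a < n" for a i
  proof (cases "i < n")
    case True
    show ?thesis
      by (rule smooth_on_in_chart_compose[OF c_s[OF True] c_inj _ openU _ in_c[OF a]]) (use U(3) a in auto)
  next
    case False
    \<comment> \<open>In a slice chart the fiber is where the coordinates from \<open>n\<close> on vanish.\<close>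
    have "snd s (tuple v a) \<in> topspace (Euclidean_space n)" if "v \<in> U" for v
      using s(1) U(3)[OF that a] by (auto simp: slice_charts_def)
    then show ?thesis
      using False by (intro smooth_on_zero openU) (auto simp: topspace_Euclidean_space)
  qed
  have in_b: "smooth_on (n * n) U (\<lambda>v. snd b (tuple v a) i)" if a: "a < n" and i: "i < N" for a i
    by (rule smooth_on_in_chart_compose[OF s_b[OF i] is_chartD(4)[OF s_chart] _ openU _ in_s[OF a]])
      (use U(3) a in auto)
  have in_B: "smooth_on (n * n) U (\<lambda>v. snd ?B (tuple v) k)" if k: "k < n * N" for k
  proof -
    have "N > 0" using k by (cases "N = 0") auto
    then have "k div N < n" "k mod N < N" using k by (auto simp: less_mult_imp_div_less)
    from in_b[OF this] show ?thesis using k by (simp add: power_chart_def)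
  qed
  have B_inj: "inj_on (snd ?B) (fst ?B)"
    by (rule power_chart_inj[OF is_chartD(4,5)[OF b_chart]])
  have B_in: "tuple v \<in> fst ?B" if "v \<in> U" for v
    using that by (auto simp: U_def W_def power_chart_def PiE_iff)
  have in_C: "smooth_on (n * n) U (\<lambda>v. snd C (tuple v) i)" for i
  proof (cases "i < n * N")
    case True
    show ?thesis
      by (rule smooth_on_in_chart_compose[OF B_C[OF True] B_inj _ openU _ in_B]) (use U(2) B_in in auto)
  next
    case False
    then show ?thesis
      using U(2) is_chartD(5)[OF C_chart] by (intro smooth_on_zero openU) auto
  qed
  have "smooth_on (n * n) U (\<lambda>v. \<Omega> (tuple v))"
  proof (rule smooth_on_in_chart_compose[where e = k and s = "(fst C \<inter> nerve n G, snd C)"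
        and A = "fst C \<inter> nerve n G" and f = \<Omega> and \<gamma> = tuple])
    show "smooth_on k (snd (fst C \<inter> nerve n G, snd C) ` (fst C \<inter> nerve n G))
        (in_chart (fst C \<inter> nerve n G, snd C) \<Omega>)"
      using \<Omega>_smooth by simp
    show "inj_on (snd (fst C \<inter> nerve n G, snd C)) (fst (fst C \<inter> nerve n G, snd C))"
      using is_chartD(4)[OF C_chart] by (auto intro: inj_on_subset)
    show "tuple v \<in> fst C \<inter> nerve n G" if "v \<in> U" for v
      using U[OF that] tuple_in_nerve by auto
  qed (use openU in_C in auto)
  then have "smooth_on (n * n) U F"
    by (rule smooth_on_cong) (use in_chart_eq U(1) in auto)
  moreover have "U \<subseteq> chart_range" by (auto simp: U_def)
  ultimately show ?thesis using diag that by blast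
qed

lemma permute_blocks_in_chart_range:
  assumes "\<sigma> permutes {..<n}" "v \<in> chart_range"
  shows "permute_blocks n \<sigma> v \<in> chart_range" "tuple (permute_blocks n \<sigma> v) = permute_args n \<sigma> (tuple v)"
proof -
  have \<sigma>: "\<sigma> a < n" if "a < n" for a using permutes_in_image[OF assms(1)] that by auto
  have b: "block a (permute_blocks n \<sigma> v) = block (\<sigma> a) v" if "a < n" for a
    using that block_index_less[OF that, of _ n] by (auto simp: block_def permute_blocks_def fun_eq_iff)
  then show "permute_blocks n \<sigma> v \<in> chart_range"
    using assms(2) \<sigma> by (auto simp: chart_range_def topspace_Euclidean_space) (simp add: permute_blocks_def)
  show "tuple (permute_blocks n \<sigma> v) = permute_args n \<sigma> (tuple v)"
    unfolding tuple_def permute_args_def by (rule restrict_ext) (use b \<sigma> in simp)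
qed

lemma Alt_tuple:
  assumes "v \<in> chart_range"
  shows "Alt n \<Omega> (tuple v) = \<Omega> (tuple v)"
proof -
  have "(\<Sum>\<sigma> | \<sigma> permutes {..<n}. of_int (sign \<sigma>) * \<Omega> (permute_args n \<sigma> (tuple v))) =
      (\<Sum>\<sigma> | \<sigma> permutes {..<n}. \<Omega> (tuple v))"
  proof (intro sum.cong refl)
    fix \<sigma> assume "\<sigma> \<in> {\<sigma>. \<sigma> permutes {..<n}}"
    then have "\<Omega> (permute_args n \<sigma> (tuple v)) = of_int (sign \<sigma>) * \<Omega> (tuple v)"
      using antisym tuple_in_nerve[OF assms] by (auto simp: antisymmetric_cochain_def)
    moreover have "of_int (sign \<sigma>) * (of_int (sign \<sigma>) * z) = (z :: complex)" for z
      by (simp add: sign_def)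
    ultimately show "of_int (sign \<sigma>) * \<Omega> (permute_args n \<sigma> (tuple v)) = \<Omega> (tuple v)" by simp
  qed
  also have "\<dots> = fact n * \<Omega> (tuple v)"
    by (simp add: card_permutations[of "{..<n}" n])
  finally show ?thesis by (simp add: Alt_def)
qed

text \<open>
  The derivations of the van Est map, applied slot by slot, are partial derivatives of the coordinate
  expression. The slots from \<open>j\<close> on have to be at the identity arrow, where the tangent vectors live.
\<close>

lemma slots_eq_pds:
  assumes U: "openin (Euclidean_space (n * n)) U" "U \<subseteq> chart_range"
    and "v \<in> U" "j \<le> n" "\<And>a. j \<le> a \<Longrightarrow> a < n \<Longrightarrow> block a v = q"
  shows "foldr (\<lambda>a. apply_slot a (coord_vector c e a)) [j..<n] (Alt n \<Omega>) (tuple v) =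
    foldr pd (map (\<lambda>a. a * n + a) [j..<n]) F v"
  using assms(4,3,5)
proof (induction j arbitrary: v rule: inc_induct)
  case base
  then show ?case using U Alt_tuple in_chart_eq by auto
next
  case (step j)
  let ?H = "foldr (\<lambda>a. apply_slot a (coord_vector c e a)) [Suc j..<n] (Alt n \<Omega>)"
  let ?g = "foldr pd (map (\<lambda>a. a * n + a) [Suc j..<n]) F"
  have j: "j < n" by fact
  have vj: "block j v = q" using step.prems j by simp
  then have q_j: "q j = v (j * n + j)" using j by (metis block_def)
  have other: "block a (v(j * n + j := t)) = block a v" if "a < n" "a \<noteq> j" for a t
  proof -
    have "a * n + i \<noteq> j * n + j" if "i < n" for i
    proof
      assume "a * n + i = j * n + j"
      then have "(a * n + i) div n = (j * n + j) div n" by simp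
      then show False using that j \<open>a \<noteq> j\<close> by simp
    qed
    then show ?thesis by (auto simp: block_def fun_eq_iff)
  qed
  have this_one: "block j (v(j * n + j := t)) = q(j := t)" for t
    unfolding vj[symmetric] using j by (auto simp: block_def fun_eq_iff)
  have tuple_upd: "(tuple v)(j := \<psi> (q(j := t))) = tuple (v(j * n + j := t))" for t
  proof
    fix a
    show "((tuple v)(j := \<psi> (q(j := t)))) a = tuple (v(j * n + j := t)) a"
    proof (cases "a = j")
      case True
      then show ?thesis using j this_one by (simp add: tuple_def del: fun_upd_apply add: fun_upd_same)
    next
      case False
      then have "((tuple v)(j := \<psi> (q(j := t)))) a = tuple v a" by simp
      also have "\<dots> = tuple (v(j * n + j := t)) a"
        unfolding tuple_def using other[OF _ False] by (cases "a < n") (simp_all del: fun_upd_apply)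
      finally show ?thesis .
    qed
  qed
  have ev: "\<forall>\<^sub>F t in nhds (v (j * n + j)). ?H ((tuple v)(j := \<psi> (q(j := t)))) = ?g (v(j * n + j := t))"
    using eventually_line_in[OF U(1) step.prems(1) block_index_less[OF j j]]
  proof (rule eventually_mono)
    fix t assume "v(j * n + j := t) \<in> U"
    then have "?H (tuple (v(j * n + j := t))) = ?g (v(j * n + j := t))"
      by (rule step.IH) (use step.prems(2) other in \<open>auto simp del: fun_upd_apply\<close>)
    then show "?H ((tuple v)(j := \<psi> (q(j := t)))) = ?g (v(j * n + j := t))"
      unfolding tuple_upd .
  qed
  have "foldr (\<lambda>a. apply_slot a (coord_vector c e a)) [j..<n] (Alt n \<Omega>) (tuple v) =
      vector_derivative (\<lambda>t. ?H ((tuple v)(j := \<psi> (q(j := t))))) (at (q j))"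
    using j by (simp add: upt_conv_Cons apply_slot_def coord_vector_def pd_def in_chart_def del: fun_upd_apply)
  also have "\<dots> = vector_derivative (\<lambda>t. ?g (v(j * n + j := t))) (at (v (j * n + j)))"
    unfolding q_j by (rule vector_derivative_cong_eq) (use ev in auto)
  also have "\<dots> = foldr pd (map (\<lambda>a. a * n + a) [j..<n]) F v"
    using j by (simp add: upt_conv_Cons pd_def del: fun_upd_apply)
  finally show ?case .
qed

text \<open>
  Normalization and antisymmetry of \<open>\<Omega>\<close> become those of its coordinate expression, and the van Est map
  becomes \<open>n!\<close> times its mixed derivative, one differentiation in each slot.
\<close>

theorem taylor_polynomial_VE:
  "is_taylor_polynomial n (n * n) F (snd (power_chart n n (\<lambda>_. c)) (ident_tuple n G x))
     (\<lambda>y. 1 / fact n * VE n G \<Omega> x (coord_vector c e) * of_real (Vol_Delta n q y))"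
proof -
  obtain U where U: "diagonal_point n q \<in> U" "U \<subseteq> chart_range" "smooth_on (n * n) U F"
    by (rule smooth_near_diagonal)
  interpret F: antisymmetric_block_function n q U F
  proof
    show "smooth_on (n * n) U F" "diagonal_point n q \<in> U" by fact+
    show "F v = 0" if "a < n" "v \<in> U" "\<forall>i<n. v (a * n + i) = q i" for a v
    proof -
      have v: "v \<in> chart_range" using that U by auto
      have "block a v = q" using that(3) c_zero[OF ident_in] by (auto simp: block_def fun_eq_iff)
      then have "tuple v a = e" using that(1) by (simp add: tuple_def \<psi>_q)
      then have "\<Omega> (tuple v) = 0"
        using normalized tuple_in_nerve[OF v] that(1) x by (auto simp: normalized_def)
      then show ?thesis using in_chart_eq[OF v] by simp
    qed
    show "F (permute_blocks n \<sigma> v) = of_int (sign \<sigma>) * F v" if "\<sigma> permutes {..<n}" "v \<in> U" for \<sigma> v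
    proof -
      have v: "v \<in> chart_range" using that U by auto
      show ?thesis
        using antisym tuple_in_nerve[OF v] that(1) permute_blocks_in_chart_range[OF that(1) v]
        by (simp add: in_chart_eq v antisymmetric_cochain_def)
    qed
  qed
  have "openin (Euclidean_space (n * n)) U" using U(3) by (simp add: smooth_on_def)
  from slots_eq_pds[OF this U(2,1), of 0]
  have VE: "VE n G \<Omega> x (coord_vector c e) = fact n * F.slot_derivative (\<lambda>a. a)"
    unfolding VE_def F.slot_derivative_def tuple_diagonal[symmetric] by (simp add: block_diagonal)
  have "snd (power_chart n n (\<lambda>_. c)) (ident_tuple n G x) = diagonal_point n q"
    by (auto simp: power_chart_def ident_tuple_def diagonal_point_def fun_eq_iff less_mult_imp_div_less)
  then show ?thesis using F.taylor_polynomial by (simp add: VE)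
qed

end

theorem corollary1p4:
  fixes G :: "('g, 'x) groupoid"
    and n :: nat
    and \<Omega> :: "(nat \<Rightarrow> 'g) \<Rightarrow> complex"
    and x :: 'x
    and c :: "'g chart"
  assumes "lie_groupoid G"
    and "n \<ge> 1"
    and "src_fibers_dim n G"
    and "cochain n G \<Omega>"
    and "normalized n G \<Omega>"
    and "antisymmetric_cochain n G \<Omega>"
    and "x \<in> Obj G"
    and "c \<in> maximal_atlas (src_fiber_mfd n G x)"
    and "ident G x \<in> fst c"
  shows "is_taylor_polynomial n (n * n)
           (in_chart (power_chart n n (\<lambda>_. c)) \<Omega>)
           (snd (power_chart n n (\<lambda>_. c)) (ident_tuple n G x))
           (\<lambda>y. 1 / fact n * VE n G \<Omega> x (coord_vector c (ident G x))
                  * of_real (Vol_Delta n (snd c (ident G x)) y))"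
proof -
  interpret cochain_at_object G n \<Omega> x c
    by unfold_locales (fact assms)+
  show ?thesis by (rule taylor_polynomial_VE)
qed

end
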